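(* The conjugation action of $\mathrm{Aut}(\mathbb{P})$ on $I(\mathbb{P})$, given by $(g,h)\mapsto ghg^{-1}$ for $g\in \mathrm{Aut}(\mathbb{P})$ and $h\in I(\mathbb{P})$, has a dense orbit (that is, some orbit is dense in $I(\mathbb{P})$).
   Context: Let $r$ be a binary relation symbol. A topological $\{r\}$-structure is a compact zero-dimensional second-countable space $A$ with a closed binary relation $r^A$. An epimorphism $\phi\colon B\to A$ of topological $\{r\}$-structures is a continuous surjection such that for all $x_1,x_2\in A$: $r^A(x_1,x_2)$ holds if and only if there are $y_1,y_2\in B$ with $\phi(y_1)=x_1$, $\phi(y_2)=x_2$ and $r^B(y_1,y_2)$. An isomorphism is a bijective epimorphism. For $n\ge 1$ let $[n]=\{1,\dots,n\}$. $\mathcal{G}$ is the family of finite reflexive linear graphs, i.e. (discrete) structures $A=([n],r^A)$ with $r^A(x,y)$ iff $|x-y|\le 1$. $\mathbb{P}$ is the projective Fraïssé limit of $\mathcal{G}$: the topological $\{r\}$-structure (it exists and is unique up to isomorphism) such that (L1) for every $A\in\mathcal{G}$ there is an epimorphism $\mathbb{P}\to A$; (L2) for every finite discrete space $X$ and continuous $f\colon\mathbb{P}\to X$ there are $A\in\mathcal{G}$, an epimorphism $\phi\colon\mathbb{P}\to A$ and a function $f_0\colon A\to X$ with $f=f_0\circ\phi$; (L3) for every $A\in\mathcal{G}$ and epimorphisms $\phi_1,\phi_2\colon\mathbb{P}\to A$ there is an isomorphism $\psi\colon\mathbb{P}\to\mathbb{P}$ with $\phi_2=\phi_1\circ\psi$.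 $\mathrm{Aut}(\mathbb{P})$ is the group of homeomorphisms $f\colon\mathbb{P}\to\mathbb{P}$ such that $r^{\mathbb{P}}(x,y)\iff r^{\mathbb{P}}(f(x),f(y))$ for all $x,y$, with the topology inherited from the compact-open topology on the homeomorphism group of $\mathbb{P}$. $I(\mathbb{P})=\{f\in\mathrm{Aut}(\mathbb{P})\colon f^2=\mathrm{id}\}$ with the subspace topology. *)

theory Defs
  imports "HOL-Analysis.Analysis" "HOL-Algebra.Group_Action"
begin

section \<open>Topological structures with one binary relation\<close>

record 'a rstruct =
  top_of :: "'a topology"
  rel_of :: "'a rel"

abbreviation pts :: "'a rstruct \<Rightarrow> 'a set" where
  "pts A \<equiv> topspace (top_of A)"

definition zero_dim_space :: "'a topology \<Rightarrow> bool" where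
  "zero_dim_space X \<longleftrightarrow>
     (\<forall>U x. openin X U \<and> x \<in> U \<longrightarrow> (\<exists>V. openin X V \<and> closedin X V \<and> x \<in> V \<and> V \<subseteq> U))"

text \<open>
  Spaces are Hausdorff by the usual convention for zero-dimensional compact spaces; without it the
  projective Fraisse limit would not be unique (points could be replaced by indistinguishable
  copies).  Closedness of the relation in the product includes that it is a relation on the points.
\<close>

definition topological_rstruct :: "'a rstruct \<Rightarrow> bool" where
  "topological_rstruct A \<longleftrightarrow>
     compact_space (top_of A) \<and> Hausdorff_space (top_of A) \<and>
     zero_dim_space (top_of A) \<and> second_countable (top_of A) \<and>
     closedin (prod_topology (top_of A) (top_of A)) (rel_of A)"

definition epimorphism :: "'b rstruct \<Rightarrow> 'a rstruct \<Rightarrow> ('b \<Rightarrow> 'a) \<Rightarrow> bool" where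
  "epimorphism B A \<phi> \<longleftrightarrow>
     continuous_map (top_of B) (top_of A) \<phi> \<and> \<phi> ` pts B = pts A \<and>
     (\<forall>x1\<in>pts A. \<forall>x2\<in>pts A.
        (x1, x2) \<in> rel_of A \<longleftrightarrow>
        (\<exists>y1\<in>pts B. \<exists>y2\<in>pts B. \<phi> y1 = x1 \<and> \<phi> y2 = x2 \<and> (y1, y2) \<in> rel_of B))"

definition isomorphism :: "'b rstruct \<Rightarrow> 'a rstruct \<Rightarrow> ('b \<Rightarrow> 'a) \<Rightarrow> bool" where
  "isomorphism B A \<phi> \<longleftrightarrow> epimorphism B A \<phi> \<and> bij_betw \<phi> (pts B) (pts A)"


section \<open>Finite reflexive linear graphs and their projective Fraisse limit\<close>

definition linear_graph :: "nat \<Rightarrow> nat rstruct" where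
  "linear_graph n =
     \<lparr>top_of = discrete_topology {1..n},
      rel_of = {(x, y). x \<in> {1..n} \<and> y \<in> {1..n} \<and> \<bar>int x - int y\<bar> \<le> 1}\<rparr>"

definition linear_graphs :: "nat rstruct set" where
  "linear_graphs = {linear_graph n | n. n \<ge> 1}"

text \<open>
  In the factorisation condition the finite discrete space ranges over the finite sets of natural
  numbers, as one cannot quantify over types inside a definition; the lemma
  \<open>limit_factor_any_type\<close> below recovers the condition for finite discrete spaces of any type.
\<close>

definition projective_Fraisse_limit :: "'a rstruct \<Rightarrow> bool" where
  "projective_Fraisse_limit P \<longleftrightarrow>
     topological_rstruct P \<and>
     (\<forall>A\<in>linear_graphs. \<exists>\<phi>. epimorphism P A \<phi>) \<and>
     (\<forall>(X :: nat set) f. finite X \<and> continuous_map (top_of P) (discrete_topology X) f \<longrightarrow>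
        (\<exists>A\<in>linear_graphs. \<exists>\<phi> f0.
           epimorphism P A \<phi> \<and> f0 \<in> pts A \<rightarrow> X \<and> (\<forall>x\<in>pts P. f x = f0 (\<phi> x)))) \<and>
     (\<forall>A\<in>linear_graphs. \<forall>\<phi>1 \<phi>2. epimorphism P A \<phi>1 \<and> epimorphism P A \<phi>2 \<longrightarrow>
        (\<exists>\<psi>. isomorphism P P \<psi> \<and> (\<forall>x\<in>pts P. \<phi>2 x = \<phi>1 (\<psi> x))))"

lemma limit_factor_any_type:
  fixes X :: "'c set"
  assumes P: "projective_Fraisse_limit P" and X: "finite X"
    and f: "continuous_map (top_of P) (discrete_topology X) f"
  shows "\<exists>A\<in>linear_graphs. \<exists>\<phi> f0.
           epimorphism P A \<phi> \<and> f0 \<in> pts A \<rightarrow> X \<and> (\<forall>x\<in>pts P. f x = f0 (\<phi> x))"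
proof -
  obtain e :: "'c \<Rightarrow> nat" where e: "inj_on e X"
    using X finite_imp_inj_to_nat_seg by blast
  have "continuous_map (discrete_topology X) (discrete_topology (e ` X)) e"
    by (auto simp: continuous_map_def)
  with f have "continuous_map (top_of P) (discrete_topology (e ` X)) (e \<circ> f)"
    by (rule continuous_map_compose)
  then have ef: "finite (e ` X) \<and>
      continuous_map (top_of P) (discrete_topology (e ` X)) (e \<circ> f)"
    using X by simp
  have "\<forall>(X :: nat set) f. finite X \<and> continuous_map (top_of P) (discrete_topology X) f \<longrightarrow>
      (\<exists>A\<in>linear_graphs. \<exists>\<phi> f0.
         epimorphism P A \<phi> \<and> f0 \<in> pts A \<rightarrow> X \<and> (\<forall>x\<in>pts P. f x = f0 (\<phi> x)))"
    using P unfolding projective_Fraisse_limit_def by (elim conjE)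
  from this[THEN spec, THEN spec, THEN mp, OF ef]
  obtain A \<phi> f0 where A: "A \<in> linear_graphs" "epimorphism P A \<phi>"
    "f0 \<in> pts A \<rightarrow> e ` X" "\<forall>x\<in>pts P. (e \<circ> f) x = f0 (\<phi> x)"
    by blast
  have fX: "f x \<in> X" if "x \<in> pts P" for x
    using f that by (auto simp: continuous_map_def)
  have "(inv_into X e \<circ> f0) \<in> pts A \<rightarrow> X"
    using A(3) by (auto simp: Pi_iff intro!: inv_into_into)
  moreover have "\<forall>x\<in>pts P. f x = (inv_into X e \<circ> f0) (\<phi> x)"
    using A(4) e fX by (metis comp_apply inv_into_f_f)
  ultimately show ?thesis using A(1,2) by blast
qed


section \<open>Homeomorphism groups with the compact-open topology\<close>

text \<open>
  Maps on the points of a space are represented by extensional functions, so that equality of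
  functions is equality on the points, and composition is the multiplication of \<^const>\<open>BijGroup\<close>.
\<close>

definition compact_open_topology ::
    "'a topology \<Rightarrow> 'b topology \<Rightarrow> ('a \<Rightarrow> 'b) topology" where
  "compact_open_topology X Y =
     topology_generated_by
       {{f \<in> extensional (topspace X). continuous_map X Y f \<and> f ` K \<subseteq> U} | K U.
          compactin X K \<and> openin Y U}"

lemma topspace_compact_open_topology:
  "topspace (compact_open_topology X Y) =
     {f \<in> extensional (topspace X). continuous_map X Y f}"
  (is "_ = ?C")
proof -
  have "?C \<in> {{f \<in> extensional (topspace X). continuous_map X Y f \<and> f ` K \<subseteq> U} | K U.
          compactin X K \<and> openin Y U}"
    by (rule CollectI, rule exI[of _ "{}"], rule exI[of _ "{}"]) auto
  then show ?thesis
    unfolding compact_open_topology_def topology_generated_by_topspace by blast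
qed

definition homeos :: "'a topology \<Rightarrow> ('a \<Rightarrow> 'a) set" where
  "homeos X = {f \<in> extensional (topspace X). homeomorphic_map X X f}"

definition homeo_topology :: "'a topology \<Rightarrow> ('a \<Rightarrow> 'a) topology" where
  "homeo_topology X = subtopology (compact_open_topology X X) (homeos X)"


section \<open>The automorphism group and its involutions\<close>

definition aut_set :: "'a rstruct \<Rightarrow> ('a \<Rightarrow> 'a) set" where
  "aut_set P = {f \<in> homeos (top_of P).
     \<forall>x\<in>pts P. \<forall>y\<in>pts P. (x, y) \<in> rel_of P \<longleftrightarrow> (f x, f y) \<in> rel_of P}"

definition aut_group :: "'a rstruct \<Rightarrow> ('a \<Rightarrow> 'a) monoid" where
  "aut_group P = (BijGroup (pts P))\<lparr>carrier := aut_set P\<rparr>"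

definition aut_topology :: "'a rstruct \<Rightarrow> ('a \<Rightarrow> 'a) topology" where
  "aut_topology P = subtopology (homeo_topology (top_of P)) (aut_set P)"

definition invol_set :: "'a rstruct \<Rightarrow> ('a \<Rightarrow> 'a) set" where
  "invol_set P = {f \<in> aut_set P. f \<otimes>\<^bsub>aut_group P\<^esub> f = \<one>\<^bsub>aut_group P\<^esub>}"

definition invol_topology :: "'a rstruct \<Rightarrow> ('a \<Rightarrow> 'a) topology" where
  "invol_topology P = subtopology (aut_topology P) (invol_set P)"

definition conj_action :: "'a rstruct \<Rightarrow> ('a \<Rightarrow> 'a) \<Rightarrow> ('a \<Rightarrow> 'a) \<Rightarrow> ('a \<Rightarrow> 'a)" where
  "conj_action P = (\<lambda>g. \<lambda>h\<in>invol_set P.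
     g \<otimes>\<^bsub>aut_group P\<^esub> h \<otimes>\<^bsub>aut_group P\<^esub> inv\<^bsub>aut_group P\<^esub> g)"

lemma homeos_subset_Bij: "homeos X \<subseteq> Bij (topspace X)"
  by (auto simp: homeos_def Bij_def bij_betw_def homeomorphic_eq_everything_map)

lemma topspace_aut_topology: "topspace (aut_topology P) = aut_set P"
  by (auto simp: aut_topology_def homeo_topology_def topspace_compact_open_topology
      aut_set_def homeos_def homeomorphic_imp_continuous_map)

lemma topspace_invol_topology: "topspace (invol_topology P) = invol_set P"
  by (auto simp: invol_topology_def topspace_aut_topology invol_set_def)

lemma aut_set_subgroup: "subgroup (aut_set P) (BijGroup (pts P))"
proof -
  let ?S = "pts P" and ?X = "top_of P"
  interpret G: group "BijGroup ?S" by (rule group_BijGroup)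
  have Bij: "f \<in> Bij ?S" if "f \<in> aut_set P" for f
    using that homeos_subset_Bij by (auto simp: aut_set_def)
  show ?thesis
  proof (rule G.subgroupI)
    show "aut_set P \<subseteq> carrier (BijGroup ?S)"
      using Bij by (auto simp: BijGroup_def)
    have "homeomorphic_map ?X ?X id" by simp
    then have "homeomorphic_map ?X ?X (restrict id ?S)"
      by (rule homeomorphic_map_eq) simp
    then have "restrict id ?S \<in> aut_set P"
      by (auto simp: aut_set_def homeos_def)
    then show "aut_set P \<noteq> {}" by blast
  next
    fix f assume f: "f \<in> aut_set P"
    then have fB: "f \<in> Bij ?S" by (rule Bij)
    let ?g = "restrict (inv_into ?S f) ?S"
    from f have hf: "homeomorphic_map ?X ?X f" by (auto simp: aut_set_def homeos_def)
    then obtain g where g: "homeomorphic_maps ?X ?X f g"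
      using homeomorphic_map_maps by blast
    have eq: "g x = ?g x" if "x \<in> ?S" for x
      using g that fB by (auto simp: homeomorphic_maps_def Bij_def bij_betw_def continuous_map_def
          Pi_iff intro!: inv_into_f_eq[symmetric])
    have "homeomorphic_map ?X ?X g"
      using g homeomorphic_maps_map by blast
    then have hg: "homeomorphic_map ?X ?X ?g"
      by (rule homeomorphic_map_eq) (rule eq)
    have gS: "?g x \<in> ?S" "f (?g x) = x" if "x \<in> ?S" for x
      using that fB by (auto simp: Bij_def bij_betw_def inv_into_into f_inv_into_f)
    have "(x, y) \<in> rel_of P \<longleftrightarrow> (?g x, ?g y) \<in> rel_of P" if "x \<in> ?S" "y \<in> ?S" for x y
    proof -
      have "(?g x, ?g y) \<in> rel_of P \<longleftrightarrow> (f (?g x), f (?g y)) \<in> rel_of P"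
        using f gS(1)[OF that(1)] gS(1)[OF that(2)] unfolding aut_set_def by blast
      then show ?thesis by (simp only: gS(2)[OF that(1)] gS(2)[OF that(2)])
    qed
    with hg have "?g \<in> aut_set P"
      unfolding aut_set_def homeos_def by blast
    then show "inv\<^bsub>BijGroup ?S\<^esub> f \<in> aut_set P"
      by (simp add: inv_BijGroup fB)
  next
    fix f g assume fg: "f \<in> aut_set P" "g \<in> aut_set P"
    have "homeomorphic_map ?X ?X (f \<circ> g)"
      using fg homeomorphic_map_compose by (fastforce simp: aut_set_def homeos_def)
    then have "homeomorphic_map ?X ?X (compose ?S f g)"
      by (rule homeomorphic_map_eq) (simp add: compose_def)
    moreover have "g x \<in> ?S" if "x \<in> ?S" for x
      using Bij[OF fg(2)] that by (auto simp: Bij_def bij_betw_def)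
    ultimately have "compose ?S f g \<in> aut_set P"
      using fg by (auto simp: aut_set_def homeos_def compose_eq)
    then show "f \<otimes>\<^bsub>BijGroup ?S\<^esub> g \<in> aut_set P"
      using fg Bij by (simp add: BijGroup_def)
  qed
qed

lemma group_aut_group: "group (aut_group P)"
  unfolding aut_group_def
  by (intro group.subgroup_imp_group group_BijGroup aut_set_subgroup)

lemma carrier_aut_group: "carrier (aut_group P) = aut_set P"
  by (simp add: aut_group_def)

lemma group_action_conj_action:
  "group_action (aut_group P) (invol_set P) (conj_action P)"
proof -
  interpret G: group "aut_group P" by (rule group_aut_group)
  let ?G = "aut_group P" and ?I = "invol_set P"
  have I: "h \<in> ?I \<longleftrightarrow> h \<in> carrier ?G \<and> h \<otimes>\<^bsub>?G\<^esub> h = \<one>\<^bsub>?G\<^esub>" for h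
    by (simp add: invol_set_def carrier_aut_group)
  have closed: "g \<otimes>\<^bsub>?G\<^esub> h \<otimes>\<^bsub>?G\<^esub> inv\<^bsub>?G\<^esub> g \<in> ?I" if g: "g \<in> carrier ?G" and h: "h \<in> ?I" for g h
  proof -
    from h have h': "h \<in> carrier ?G" "h \<otimes>\<^bsub>?G\<^esub> h = \<one>\<^bsub>?G\<^esub>" by (auto simp: I)
    have "(g \<otimes>\<^bsub>?G\<^esub> h \<otimes>\<^bsub>?G\<^esub> inv\<^bsub>?G\<^esub> g) \<otimes>\<^bsub>?G\<^esub> (g \<otimes>\<^bsub>?G\<^esub> h \<otimes>\<^bsub>?G\<^esub> inv\<^bsub>?G\<^esub> g)
        = g \<otimes>\<^bsub>?G\<^esub> (h \<otimes>\<^bsub>?G\<^esub> h) \<otimes>\<^bsub>?G\<^esub> inv\<^bsub>?G\<^esub> g"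
      using g h'(1) by (simp add: G.m_assoc G.inv_solve_left')
    then show ?thesis using g h' by (simp add: I)
  qed
  have comp: "conj_action P (a \<otimes>\<^bsub>?G\<^esub> b) h = conj_action P a (conj_action P b h)"
    if "a \<in> carrier ?G" "b \<in> carrier ?G" "h \<in> ?I" for a b h
    using that closed[of b h]
    by (simp add: conj_action_def I G.m_assoc G.inv_mult_group)
  have one: "conj_action P \<one>\<^bsub>?G\<^esub> h = h" if "h \<in> ?I" for h
    using that by (simp add: conj_action_def I)
  have mem: "conj_action P g h \<in> ?I" if "g \<in> carrier ?G" "h \<in> ?I" for g h
    using closed that by (simp add: conj_action_def)
  have bij: "conj_action P g \<in> Bij ?I" if g: "g \<in> carrier ?G" for g
  proof -
    have "bij_betw (conj_action P g) ?I ?I"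
    proof (rule bij_betw_byWitness[where f' = "conj_action P (inv\<^bsub>?G\<^esub> g)"])
      show "\<forall>h\<in>?I. conj_action P (inv\<^bsub>?G\<^esub> g) (conj_action P g h) = h"
        using g comp[of "inv\<^bsub>?G\<^esub> g" g] one by simp
      show "\<forall>h\<in>?I. conj_action P g (conj_action P (inv\<^bsub>?G\<^esub> g) h) = h"
        using g comp[of g "inv\<^bsub>?G\<^esub> g"] one by simp
    qed (use g mem in auto)
    then show ?thesis by (simp add: Bij_def conj_action_def)
  qed
  have "conj_action P \<in> hom ?G (BijGroup ?I)"
  proof (rule homI)
    fix g assume "g \<in> carrier ?G"
    then show "conj_action P g \<in> carrier (BijGroup ?I)" using bij by (simp add: BijGroup_def)
  next
    fix a b assume ab: "a \<in> carrier ?G" "b \<in> carrier ?G"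
    have "conj_action P (a \<otimes>\<^bsub>?G\<^esub> b) = compose ?I (conj_action P a) (conj_action P b)"
    proof (rule extensionalityI[where A = ?I])
      fix h assume "h \<in> ?I"
      then show "conj_action P (a \<otimes>\<^bsub>?G\<^esub> b) h = compose ?I (conj_action P a) (conj_action P b) h"
        using comp ab by (simp add: compose_eq)
    qed (auto simp: conj_action_def)
    then show "conj_action P (a \<otimes>\<^bsub>?G\<^esub> b) = conj_action P a \<otimes>\<^bsub>BijGroup ?I\<^esub> conj_action P b"
      using ab bij by (simp add: BijGroup_def)
  qed
  then show ?thesis
    by (intro group_action.intro group_hom.intro group_hom_axioms.intro)
      (auto simp: group_BijGroup G.group_axioms)
qed

end

theory Submission
  imports Defs
begin

text \<open>
  Let \<open>flip m\<close> be the reflection of the linear graph on \<open>[m]\<close>.  The pairs \<open>([m], flip m)\<close> are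
  cofinal among the finite approximations of involutions: if \<open>h\<close> is an involution of the limit and
  \<open>\<phi>\<close> an epimorphism onto \<open>[n]\<close>, then the image of \<open>x \<mapsto> (\<phi> x, \<phi> (h x))\<close> is a symmetric connected
  subgraph of \<open>[n] \<times> [n]\<close> that comes close to the diagonal, so it is covered by a walk that the
  exchange of coordinates reverses.  Any \<open>([m], flip m)\<close> and \<open>([q], flip q)\<close> are both quotients of
  \<open>([m q], flip (m q))\<close>, so a single involution that projects onto all of them can be built as an
  inverse limit on the limit structure itself.  Its conjugates are dense by homogeneity.
\<close>

section \<open>Epimorphisms\<close>

lemma epimorphism_continuous: "epimorphism B A \<phi> \<Longrightarrow> continuous_map (top_of B) (top_of A) \<phi>"
  by (simp add: epimorphism_def)

lemma epimorphism_onto: "epimorphism B A \<phi> \<Longrightarrow> \<phi> ` pts B = pts A"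
  by (simp add: epimorphism_def)

lemma epimorphism_image: "epimorphism B A \<phi> \<Longrightarrow> x \<in> pts B \<Longrightarrow> \<phi> x \<in> pts A"
  using epimorphism_onto by blast

lemma epimorphism_surj:
  assumes "epimorphism B A \<phi>" "y \<in> pts A"
  obtains x where "x \<in> pts B" "\<phi> x = y"
proof -
  have "y \<in> \<phi> ` pts B" using assms(2) by (simp only: epimorphism_onto[OF assms(1)])
  then show thesis using that by blast
qed

lemma epimorphism_rel_iff:
  assumes "epimorphism B A \<phi>" "x \<in> pts A" "y \<in> pts A"
  shows "(x, y) \<in> rel_of A \<longleftrightarrow>
    (\<exists>x'\<in>pts B. \<exists>y'\<in>pts B. \<phi> x' = x \<and> \<phi> y' = y \<and> (x', y') \<in> rel_of B)"
proof -
  have "\<forall>x\<in>pts A. \<forall>y\<in>pts A. (x, y) \<in> rel_of A \<longleftrightarrow>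
      (\<exists>x'\<in>pts B. \<exists>y'\<in>pts B. \<phi> x' = x \<and> \<phi> y' = y \<and> (x', y') \<in> rel_of B)"
    using assms(1) unfolding epimorphism_def by (elim conjE)
  from this[THEN bspec, THEN bspec, OF assms(2,3)] show ?thesis .
qed

lemma epimorphism_rel:
  assumes "epimorphism B A \<phi>" "x \<in> pts B" "y \<in> pts B" "(x, y) \<in> rel_of B"
  shows "(\<phi> x, \<phi> y) \<in> rel_of A"
proof -
  have "\<phi> x \<in> pts A" "\<phi> y \<in> pts A"
    by (rule epimorphism_image[OF assms(1)], fact)+
  from epimorphism_rel_iff[OF assms(1) this] show ?thesis
    using assms(2-4) by blast
qed

lemma epimorphism_lift_rel:
  assumes "epimorphism B A \<phi>" "x \<in> pts A" "y \<in> pts A" "(x, y) \<in> rel_of A"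
  obtains x' y' where "x' \<in> pts B" "y' \<in> pts B" "\<phi> x' = x" "\<phi> y' = y" "(x', y') \<in> rel_of B"
proof -
  have "\<exists>x'\<in>pts B. \<exists>y'\<in>pts B. \<phi> x' = x \<and> \<phi> y' = y \<and> (x', y') \<in> rel_of B"
    by (rule epimorphism_rel_iff[OF assms(1-3), THEN iffD1, OF assms(4)])
  then show thesis using that by blast
qed

lemma epimorphism_compose:
  assumes \<psi>: "epimorphism C B \<psi>" and \<phi>: "epimorphism B A \<phi>"
  shows "epimorphism C A (\<phi> \<circ> \<psi>)"
proof -
  have "continuous_map (top_of C) (top_of A) (\<phi> \<circ> \<psi>)"
    using epimorphism_continuous[OF \<psi>] epimorphism_continuous[OF \<phi>] by (rule continuous_map_compose)
  moreover have "(\<phi> \<circ> \<psi>) ` pts C = pts A"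
    by (simp only: image_comp[symmetric] epimorphism_onto[OF \<psi>] epimorphism_onto[OF \<phi>])
  moreover have "(x1, x2) \<in> rel_of A \<longleftrightarrow>
      (\<exists>y1\<in>pts C. \<exists>y2\<in>pts C. (\<phi> \<circ> \<psi>) y1 = x1 \<and> (\<phi> \<circ> \<psi>) y2 = x2 \<and> (y1, y2) \<in> rel_of C)"
    if x: "x1 \<in> pts A" "x2 \<in> pts A" for x1 x2
  proof
    assume "(x1, x2) \<in> rel_of A"
    then obtain y1 y2 where y: "y1 \<in> pts B" "y2 \<in> pts B" "\<phi> y1 = x1" "\<phi> y2 = x2" "(y1, y2) \<in> rel_of B"
      using epimorphism_lift_rel[OF \<phi> x] by metis
    then obtain z1 z2 where z: "z1 \<in> pts C" "z2 \<in> pts C" "\<psi> z1 = y1" "\<psi> z2 = y2" "(z1, z2) \<in> rel_of C"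
      using epimorphism_lift_rel[OF \<psi>] by metis
    show "\<exists>y1\<in>pts C. \<exists>y2\<in>pts C. (\<phi> \<circ> \<psi>) y1 = x1 \<and> (\<phi> \<circ> \<psi>) y2 = x2 \<and> (y1, y2) \<in> rel_of C"
      by (intro bexI[of _ z1] bexI[of _ z2]) (simp_all add: y z)
  next
    assume "\<exists>y1\<in>pts C. \<exists>y2\<in>pts C. (\<phi> \<circ> \<psi>) y1 = x1 \<and> (\<phi> \<circ> \<psi>) y2 = x2 \<and> (y1, y2) \<in> rel_of C"
    then obtain z1 z2 where z: "z1 \<in> pts C" "z2 \<in> pts C" "\<phi> (\<psi> z1) = x1" "\<phi> (\<psi> z2) = x2" "(z1, z2) \<in> rel_of C"
      unfolding comp_def by blast
    have "(\<phi> (\<psi> z1), \<phi> (\<psi> z2)) \<in> rel_of A"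
      by (intro epimorphism_rel[OF \<phi>] epimorphism_rel[OF \<psi>] epimorphism_image[OF \<psi>] z)
    then show "(x1, x2) \<in> rel_of A" by (simp add: z)
  qed
  ultimately show ?thesis unfolding epimorphism_def by blast
qed


section \<open>Linear graphs and their reflections\<close>

lemma top_linear_graph [simp]: "top_of (linear_graph n) = discrete_topology {1..n}"
  by (simp add: linear_graph_def)

lemma rel_linear_graph:
  "(x, y) \<in> rel_of (linear_graph n) \<longleftrightarrow> x \<in> {1..n} \<and> y \<in> {1..n} \<and> \<bar>int x - int y\<bar> \<le> 1"
  by (simp add: linear_graph_def)

text \<open>A discrete intermediate value principle: without a switch, \<open>P\<close> would
  propagate step by step from \<open>a\<close> to \<open>b\<close>. It locates the place where a
  walk crosses a level or the diagonal.\<close>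

lemma last_before_switch:
  fixes a b :: nat
  assumes "a \<le> b" "P a" "\<not> P b"
  obtains i where "a \<le> i" "i < b" "P i" "\<not> P (Suc i)"
  using assms
proof (induction b arbitrary: thesis)
  case (Suc b)
  then show ?case by (metis le_SucE lessI less_SucI)
qed auto

text \<open>Steps of size at most one preserve adjacency. Conversely, a walk from a preimage of
  \<open>i\<close> to a preimage of \<open>Suc i\<close>, in either direction, crosses between these
  levels in a single step, and this step must have exactly \<open>i\<close> and \<open>Suc i\<close>
  as its ends; so every edge lifts. Loops lift by surjectivity.\<close>

lemma epimorphism_linear_graphI:
  assumes surj: "k ` {1..m} = {1..n}"
    and step: "\<And>c. 1 \<le> c \<Longrightarrow> c < m \<Longrightarrow> \<bar>int (k (Suc c)) - int (k c)\<bar> \<le> 1"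
  shows "epimorphism (linear_graph m) (linear_graph n) k"
proof -
  have edge: "\<exists>c. 1 \<le> c \<and> c < m \<and> {k c, k (Suc c)} = {i, Suc i}" if i: "1 \<le> i" "i < n" for i
  proof -
    obtain a where a: "a \<in> {1..m}" "k a = i" using surj i by (metis atLeastAtMost_iff imageE less_imp_le)
    obtain b where b: "b \<in> {1..m}" "k b = Suc i" using surj i
      by (metis Suc_leI atLeastAtMost_iff imageE le_SucI)
    show ?thesis
    proof (cases "a \<le> b")
      case True
      obtain c where c: "a \<le> c" "c < b" "k c \<le> i" "\<not> k (Suc c) \<le> i"
        using last_before_switch[of a b "\<lambda>c. k c \<le> i"] True a b by auto
      with step[of c] a b have "k c = i" "k (Suc c) = Suc i" by auto
      with c a b show ?thesis by (intro exI[of _ c]) auto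
    next
      case False
      obtain c where c: "b \<le> c" "c < a" "\<not> k c \<le> i" "\<not> \<not> k (Suc c) \<le> i"
        using last_before_switch[of b a "\<lambda>c. \<not> k c \<le> i"] False a b by auto
      with step[of c] a b have "k c = Suc i" "k (Suc c) = i" by auto
      with c a b show ?thesis by (intro exI[of _ c]) auto
    qed
  qed
  have lift: "\<exists>y1\<in>{1..m}. \<exists>y2\<in>{1..m}. k y1 = x1 \<and> k y2 = x2 \<and> \<bar>int y1 - int y2\<bar> \<le> 1"
    if x: "x1 \<in> {1..n}" "x2 \<in> {1..n}" "\<bar>int x1 - int x2\<bar> \<le> 1" for x1 x2
  proof -
    consider "x1 = x2" | "x2 = Suc x1" | "x1 = Suc x2" using x(3) by linarith
    then show ?thesis
    proof cases
      case 1
      then show ?thesis using surj x by (metis abs_zero diff_self imageE zero_le_one)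
    next
      case 2
      then obtain c where c: "1 \<le> c" "c < m" "{k c, k (Suc c)} = {x1, x2}" using edge[of x1] x by auto
      then consider "k c = x1" "k (Suc c) = x2" | "k c = x2" "k (Suc c) = x1" by (auto simp: doubleton_eq_iff)
      then show ?thesis
      proof cases
        case 1 with c show ?thesis by (intro bexI[of _ c] bexI[of _ "Suc c"]) auto
      next
        case 2 with c show ?thesis by (intro bexI[of _ c] bexI[of _ "Suc c"]) auto
      qed
    next
      case 3
      then obtain c where c: "1 \<le> c" "c < m" "{k c, k (Suc c)} = {x2, x1}" using edge[of x2] x by auto
      then consider "k c = x1" "k (Suc c) = x2" | "k c = x2" "k (Suc c) = x1" by (auto simp: doubleton_eq_iff)
      then show ?thesis
      proof cases
        case 1 with c show ?thesis by (intro bexI[of _ c] bexI[of _ "Suc c"]) auto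
      next
        case 2 with c show ?thesis by (intro bexI[of _ c] bexI[of _ "Suc c"]) auto
      qed
    qed
  qed
  have nonexp: "\<bar>int (k y1) - int (k y2)\<bar> \<le> 1"
    if y: "y1 \<in> {1..m}" "y2 \<in> {1..m}" "\<bar>int y1 - int y2\<bar> \<le> 1" for y1 y2
  proof -
    consider "y1 = y2" | "y2 = Suc y1" | "y1 = Suc y2" using y(3) by linarith
    then show ?thesis using y step[of y1] step[of y2] by cases auto
  qed
  show ?thesis
    unfolding epimorphism_def using surj lift nonexp
    by (auto simp: rel_linear_graph continuous_map_def)
qed

lemma epimorphism_linear_graph_step:
  assumes "epimorphism (linear_graph m) (linear_graph n) k" "1 \<le> c" "c < m"
  shows "\<bar>int (k (Suc c)) - int (k c)\<bar> \<le> 1"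
  using epimorphism_rel[OF assms(1), of "Suc c" c] assms(2,3) by (auto simp: rel_linear_graph)

lemma epimorphism_linear_graph_image:
  assumes "epimorphism (linear_graph m) (linear_graph n) k"
  shows "k ` {1..m} = {1..n}"
  using assms by (simp add: epimorphism_def)

section \<open>Reflections and block maps of linear graphs\<close>

definition flip :: "nat \<Rightarrow> nat \<Rightarrow> nat" where
  "flip m c = Suc m - c"

lemma flip_in [simp]: "c \<in> {1..m} \<Longrightarrow> flip m c \<in> {1..m}"
  by (auto simp: flip_def)

lemma flip_flip [simp]: "c \<in> {1..m} \<Longrightarrow> flip m (flip m c) = c"
  by (auto simp: flip_def)

lemma flip_rel_iff:
  assumes "a \<in> {1..m}" "b \<in> {1..m}"
  shows "(flip m a, flip m b) \<in> rel_of (linear_graph m) \<longleftrightarrow> (a, b) \<in> rel_of (linear_graph m)"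
  using assms by (auto simp: rel_linear_graph flip_def of_nat_diff)

lemma epimorphism_flip: "epimorphism (linear_graph m) (linear_graph m) (flip m)"
proof (rule epimorphism_linear_graphI)
  have "c \<in> flip m ` {1..m}" if "c \<in> {1..m}" for c
    using that flip_in flip_flip by (metis imageI)
  then show "flip m ` {1..m} = {1..m}" using flip_in by blast
qed (auto simp: flip_def of_nat_diff)

text \<open>This collapses consecutive intervals of length \<open>q\<close> to single vertices; the
  shifts by one translate between vertices counted from 1 and quotients counted from 0.\<close>

definition block :: "nat \<Rightarrow> nat \<Rightarrow> nat" where
  "block q c = Suc ((c - 1) div q)"

lemma epimorphism_block:
  assumes "q \<ge> 1"
  shows "epimorphism (linear_graph (m * q)) (linear_graph m) (block q)"
proof (rule epimorphism_linear_graphI)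
  have "block q c \<in> {1..m}" if "c \<in> {1..m * q}" for c
    using that assms by (auto simp: block_def Suc_le_eq div_less_iff_less_mult)
  moreover have "c \<in> block q ` {1..m * q}" if c: "c \<in> {1..m}" for c
  proof (rule image_eqI[of _ _ "Suc ((c - 1) * q)"])
    show "c = block q (Suc ((c - 1) * q))" using assms c by (simp add: block_def)
    have "(c - 1) * q < m * q" using assms c by (intro mult_strict_right_mono) auto
    then show "Suc ((c - 1) * q) \<in> {1..m * q}" by (simp only: atLeastAtMost_iff) linarith
  qed
  ultimately show "block q ` {1..m * q} = {1..m}" by blast
next
  fix c :: nat assume "1 \<le> c" "c < m * q"
  then obtain d where "c = Suc d" by (cases c) auto
  then show "\<bar>int (block q (Suc c)) - int (block q c)\<bar> \<le> 1"
    using div_Suc[of d q] by (auto simp: block_def)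
qed

text \<open>With \<open>c - 1 = a * q + r\<close> and \<open>m = Suc (a + b)\<close>, the reflected
  vertex counted from 0 is \<open>b * q + (q - Suc r)\<close>: the order of the blocks and the order
  inside each block are both reversed. Thus subdividing every vertex is compatible with the
  reflections.\<close>

lemma block_flip:
  assumes "q \<ge> 1" "c \<in> {1..m * q}"
  shows "block q (flip (m * q) c) = flip m (block q c)"
proof -
  define a r where "a = (c - 1) div q" and "r = (c - 1) mod q"
  have c: "c - 1 = a * q + r" "r < q" using assms by (auto simp: a_def r_def)
  have am: "a < m" using assms by (auto simp: a_def div_less_iff_less_mult)
  then obtain b where b: "m = Suc (a + b)" using less_imp_Suc_add by blast
  have "flip (m * q) c - 1 = b * q + (q - Suc r)"
    using c assms by (auto simp: flip_def b algebra_simps)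
  then have "(flip (m * q) c - 1) div q = b"
    using c(2) by (simp only: div_mult_self3) simp
  then have "block q (flip (m * q) c) = Suc b" by (simp only: block_def)
  moreover have "block q c = Suc a" by (simp only: block_def a_def)
  ultimately show ?thesis by (simp add: flip_def b)
qed

text \<open>The walk \<open>(a1 i, a2 i)\<close> meets a neighbourhood of the diagonal at some index \<open>j\<close>, because
  \<open>a1 - a2\<close> changes sign in steps of size at most two.  Walking through \<open>1, \<dots>, l\<close> and back to
  \<open>j\<close>, and then continuing with the mirror image with the two coordinates exchanged, gives \<open>k\<close>.\<close>

lemma symmetric_walk:
  assumes a1: "epimorphism (linear_graph l) (linear_graph n) a1"
    and a2: "epimorphism (linear_graph l) (linear_graph n) a2"
    and n: "n \<ge> 1"
  obtains m k where "m \<ge> 1" "epimorphism (linear_graph m) (linear_graph n) k"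
    "\<And>c. c \<in> {1..m} \<Longrightarrow>
      \<exists>i\<in>{1..l}. (k c, k (flip m c)) = (a1 i, a2 i) \<or> (k c, k (flip m c)) = (a2 i, a1 i)"
proof -
  note s1 = epimorphism_linear_graph_step[OF a1] and s2 = epimorphism_linear_graph_step[OF a2]
  note im1 = epimorphism_linear_graph_image[OF a1] and im2 = epimorphism_linear_graph_image[OF a2]
  have in1: "a1 i \<in> {1..n}" and in2: "a2 i \<in> {1..n}" if "i \<in> {1..l}" for i
    using that im1 im2 by auto
  \<comment> \<open>The first coordinate is minimal at \<open>p\<close> and maximal at
    \<open>q\<close>, so the walk is weakly on opposite sides of the diagonal at these two
    indices.\<close>
  obtain p where p: "p \<in> {1..l}" "a1 p = 1" using im1 n by (metis atLeastAtMost_iff imageE order_refl)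
  obtain q where q: "q \<in> {1..l}" "a1 q = n" using im1 n by (metis atLeastAtMost_iff imageE order_refl)
  have le_p: "a1 p \<le> a2 p" and ge_q: "a2 q \<le> a1 q" using p q in2[of p] in2[of q] by auto
  have "\<exists>j\<in>{1..l}. \<bar>int (a1 j) - int (a2 j)\<bar> \<le> 1"
  proof (rule ccontr)
    assume far: "\<not> ?thesis"
    then have ne: "a1 p < a2 p" "a2 q < a1 q" using le_p ge_q p(1) q(1) by force+
    have "\<exists>c. 1 \<le> c \<and> c < l \<and> (a1 c < a2 c \<longleftrightarrow> a2 (Suc c) \<le> a1 (Suc c))"
    proof (cases "p \<le> q")
      case True
      obtain c where "p \<le> c" "c < q" "a1 c < a2 c" "\<not> a1 (Suc c) < a2 (Suc c)"
        using last_before_switch[of p q "\<lambda>c. a1 c < a2 c"] True ne by auto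
      then show ?thesis using p(1) q(1) by (intro exI[of _ c]) auto
    next
      case False
      obtain c where "q \<le> c" "c < p" "\<not> a1 c < a2 c" "\<not> \<not> a1 (Suc c) < a2 (Suc c)"
        using last_before_switch[of q p "\<lambda>c. \<not> a1 c < a2 c"] False ne by auto
      then show ?thesis using p(1) q(1) by (intro exI[of _ c]) auto
    qed
    then obtain c where c: "1 \<le> c" "c < l" "a1 c < a2 c \<longleftrightarrow> a2 (Suc c) \<le> a1 (Suc c)" by blast
    then have "c \<in> {1..l}" "Suc c \<in> {1..l}" by auto
    then have "\<bar>int (a1 c) - int (a2 c)\<bar> > 1" "\<bar>int (a1 (Suc c)) - int (a2 (Suc c))\<bar> > 1"
      using far not_le by blast+
    \<comment> \<open>Differences of absolute value at least 2 and of opposite signs are at least 4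
      apart, but one step changes \<open>a1 - a2\<close> by at most 2.\<close>
    with c s1[of c] s2[of c] show False by linarith
  qed
  then obtain j where j: "1 \<le> j" "j \<le> l" "\<bar>int (a1 j) - int (a2 j)\<bar> \<le> 1" by auto
  \<comment> \<open>The outward part has \<open>l\<close> indices and the return from
    \<open>l - 1\<close> to \<open>j\<close> has \<open>l - j\<close>; \<open>u c\<close> is the
    index visited at time \<open>c\<close>. The outward part makes \<open>k\<close> surjective, and
    the return places the seam at \<open>j\<close>.\<close>
  define L where "L = 2 * l - j"
  define u where "u c = (if c \<le> l then c else 2 * l - c)" for c
  define k where "k c = (if c \<le> L then a1 (u c) else a2 (u (Suc (2 * L) - c)))" for c
  have L: "l \<le> L" "1 \<le> L" using j by (auto simp: L_def)
  have u: "u c \<in> {1..l}" if "1 \<le> c" "c \<le> L" for c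
    using that j by (auto simp: u_def L_def)
  have uL: "u L = j" using j by (auto simp: u_def L_def)
  have au: "\<bar>int (a (u (Suc c))) - int (a (u c))\<bar> \<le> 1"
    if a: "\<And>c. 1 \<le> c \<Longrightarrow> c < l \<Longrightarrow> \<bar>int (a (Suc c)) - int (a c)\<bar> \<le> 1" and c: "1 \<le> c" "c < L"
    for a :: "nat \<Rightarrow> nat" and c
  proof (cases "c < l")
    case True
    then show ?thesis using a[of c] c by (simp add: u_def)
  next
    case False
    define d where "d = 2 * l - Suc c"
    have d: "1 \<le> d" "d < l" "u (Suc c) = d" "u c = Suc d"
      using False c j by (auto simp: d_def u_def L_def)
    then show ?thesis using a[of d] by (simp add: abs_minus_commute)
  qed
  have kim: "k ` {1..2 * L} = {1..n}"
  proof
    show "k ` {1..2 * L} \<subseteq> {1..n}"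
      using in1[OF u] in2[OF u] by (auto simp: k_def)
    show "{1..n} \<subseteq> k ` {1..2 * L}"
    proof
      fix x assume "x \<in> {1..n}"
      then obtain i where "i \<in> {1..l}" "x = a1 i" using im1 by blast
      then show "x \<in> k ` {1..2 * L}"
        using L by (intro image_eqI[of _ _ i]) (auto simp: k_def u_def)
    qed
  qed
  have kstep: "\<bar>int (k (Suc c)) - int (k c)\<bar> \<le> 1" if c: "1 \<le> c" "c < 2 * L" for c
  proof -
    consider "c < L" | "c = L" | "L < c" by linarith
    then show ?thesis
    proof cases
      case 1
      then show ?thesis using au[of a1 c, OF s1] c by (simp add: k_def)
    next
      case 2
      \<comment> \<open>At the seam the walk passes from \<open>a1 j\<close> to \<open>a2 j\<close>;
        this is where closeness to the diagonal is used.\<close>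
      then show ?thesis using j uL by (simp add: k_def abs_minus_commute)
    next
      case 3
      define d where "d = 2 * L - c"
      have d: "1 \<le> d" "d < L" "Suc (2 * L) - c = Suc d" "Suc (2 * L) - Suc c = d"
        using 3 c by (auto simp: d_def)
      then show ?thesis using au[of a2 d, OF s2] 3 by (simp add: k_def abs_minus_commute)
    qed
  qed
  show thesis
  proof (rule that[of "2 * L" k])
    show "2 * L \<ge> 1" using L by simp
    show "epimorphism (linear_graph (2 * L)) (linear_graph n) k"
      using epimorphism_linear_graphI kim kstep by blast
    fix c assume c: "c \<in> {1..2 * L}"
    show "\<exists>i\<in>{1..l}. (k c, k (flip (2 * L) c)) = (a1 i, a2 i) \<or> (k c, k (flip (2 * L) c)) = (a2 i, a1 i)"
    proof (cases "c \<le> L")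
      case True
      then have "k c = a1 (u c)" "k (flip (2 * L) c) = a2 (u c)"
        using c by (auto simp: k_def flip_def)
      then show ?thesis using u[of c] c True by auto
    next
      case False
      then have "k c = a2 (u (Suc (2 * L) - c))" "k (flip (2 * L) c) = a1 (u (Suc (2 * L) - c))"
        using c by (auto simp: k_def flip_def)
      then show ?thesis using u[of "Suc (2 * L) - c"] c False by auto
    qed
  qed
qed

text \<open>The map \<open>g\<close> induced on fibres takes steps of size at most one, because each
  edge of the path \<open>[n]\<close> lifts along \<phi> to an edge of \<open>B\<close>, which
  \<theta> sends to an edge of \<open>[m]\<close>.\<close>

lemma epimorphism_factor:
  assumes \<phi>: "epimorphism B (linear_graph n) \<phi>" and \<theta>: "epimorphism B (linear_graph m) \<theta>"
    and fib: "\<And>x y. x \<in> pts B \<Longrightarrow> y \<in> pts B \<Longrightarrow> \<phi> x = \<phi> y \<Longrightarrow> \<theta> x = \<theta> y"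
  obtains g where "epimorphism (linear_graph n) (linear_graph m) g"
    "\<And>x. x \<in> pts B \<Longrightarrow> \<theta> x = g (\<phi> x)"
proof -
  define g where "g c = \<theta> (inv_into (pts B) \<phi> c)" for c
  have eq: "\<theta> x = g (\<phi> x)" if "x \<in> pts B" for x
    unfolding g_def using that by (intro fib) (simp_all add: inv_into_into f_inv_into_f)
  have "g ` {1..n} = g ` \<phi> ` pts B"
    using epimorphism_onto[OF \<phi>] by simp
  also have "\<dots> = \<theta> ` pts B"
    unfolding image_image by (rule image_cong) (simp_all add: eq)
  also have "\<dots> = {1..m}"
    using epimorphism_onto[OF \<theta>] by simp
  finally have im: "g ` {1..n} = {1..m}" .
  have step: "\<bar>int (g (Suc c)) - int (g c)\<bar> \<le> 1" if "1 \<le> c" "c < n" for c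
  proof -
    have "(c, Suc c) \<in> rel_of (linear_graph n)" using that by (simp add: rel_linear_graph)
    moreover have "c \<in> pts (linear_graph n)" "Suc c \<in> pts (linear_graph n)" using that by auto
    ultimately obtain x y where "x \<in> pts B" "y \<in> pts B" "\<phi> x = c" "\<phi> y = Suc c" "(x, y) \<in> rel_of B"
      using epimorphism_lift_rel[OF \<phi>] by metis
    moreover from this have "(\<theta> x, \<theta> y) \<in> rel_of (linear_graph m)"
      by (intro epimorphism_rel[OF \<theta>])
    ultimately show ?thesis by (auto simp: rel_linear_graph eq)
  qed
  show thesis
    using that epimorphism_linear_graphI[OF im step] eq by blast
qed


section \<open>Clopen sets\<close>

lemma fibre_clopen:
  assumes "epimorphism B (linear_graph n) \<phi>"
  shows "openin (top_of B) {x \<in> pts B. \<phi> x = i}" "closedin (top_of B) {x \<in> pts B. \<phi> x = i}"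
proof -
  have eq: "{x \<in> pts B. \<phi> x = i} = {x \<in> pts B. \<phi> x \<in> {i} \<inter> {1..n}}"
    using epimorphism_image[OF assms] by auto
  note cont = epimorphism_continuous[OF assms, unfolded top_linear_graph]
  show "openin (top_of B) {x \<in> pts B. \<phi> x = i}"
    unfolding eq by (rule openin_continuous_map_preimage[OF cont]) simp
  show "closedin (top_of B) {x \<in> pts B. \<phi> x = i}"
    unfolding eq by (rule closedin_continuous_map_preimage[OF cont]) simp
qed

text \<open>The membership pattern is constant near \<open>x\<close>, namely on the finite
  intersection of the members that contain \<open>x\<close> and the complements of the others. A
  finite clopen family thus becomes one map to a finite discrete space, to which the factorisation
  property of the limit applies.\<close>

lemma continuous_map_clopen_type:
  assumes "finite \<W>" and clopen: "\<forall>W\<in>\<W>. openin X W \<and> closedin X W"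
  shows "continuous_map X (discrete_topology (Pow \<W>)) (\<lambda>x. {W \<in> \<W>. x \<in> W})"
  unfolding continuous_map_def
proof (intro conjI allI impI)
  fix U assume "openin (discrete_topology (Pow \<W>)) U"
  let ?S = "{x \<in> topspace X. {W \<in> \<W>. x \<in> W} \<in> U}"
  show "openin X ?S"
  proof (subst openin_subopen, rule ballI)
    fix x assume x: "x \<in> ?S"
    define N where "N = (\<Inter>W\<in>\<W>. if x \<in> W then W else topspace X - W) \<inter> topspace X"
    have "openin X N"
      unfolding N_def using assms by (intro openin_INT) (auto simp: openin_diff)
    moreover have "x \<in> N" using x by (auto simp: N_def)
    moreover have "{W \<in> \<W>. y \<in> W} = {W \<in> \<W>. x \<in> W}" if "y \<in> N" for y
      using that by (auto simp: N_def split: if_splits)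
    then have "N \<subseteq> ?S" using x by (auto simp: N_def)
    ultimately show "\<exists>T. openin X T \<and> x \<in> T \<and> T \<subseteq> ?S" by blast
  qed
qed auto

section \<open>Neighbourhoods and separation by clopen sets\<close>

lemma clopen_between:
  assumes zd: "zero_dim_space X" and C: "compactin X C" and V: "openin X V" "C \<subseteq> V"
  obtains W where "openin X W" "closedin X W" "C \<subseteq> W" "W \<subseteq> V"
proof -
  let ?\<U> = "{W. openin X W \<and> closedin X W \<and> W \<subseteq> V}"
  have "C \<subseteq> \<Union>?\<U>"
  proof
    fix x assume "x \<in> C"
    then show "x \<in> \<Union>?\<U>" using zd V unfolding zero_dim_space_def by blast
  qed
  then obtain \<F> where "finite \<F>" "\<F> \<subseteq> ?\<U>" "C \<subseteq> \<Union>\<F>"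
    using C unfolding compactin_def by (metis (mono_tags, lifting) mem_Collect_eq)
  then show thesis
    by (intro that[of "\<Union>\<F>"]) (auto intro!: openin_Union closedin_Union)
qed

lemma compact_open_nbhd:
  assumes zd: "zero_dim_space Y" and U: "openin (compact_open_topology X Y) U" "f0 \<in> U"
  obtains \<W> where "finite \<W>" "\<forall>W\<in>\<W>. openin Y W \<and> closedin Y W"
    "\<forall>f. f \<in> extensional (topspace X) \<and> continuous_map X Y f \<and>
      (\<forall>W\<in>\<W>. \<forall>x\<in>topspace X. f x \<in> W \<longleftrightarrow> f0 x \<in> W) \<longrightarrow> f \<in> U"
proof -
  let ?S = "{{f \<in> extensional (topspace X). continuous_map X Y f \<and> f ` K \<subseteq> U} | K U.
          compactin X K \<and> openin Y U}"
  let ?good = "\<lambda>\<W> U. finite \<W> \<and> (\<forall>W\<in>\<W>. openin Y W \<and> closedin Y W) \<and>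
    (\<forall>f. f \<in> extensional (topspace X) \<and> continuous_map X Y f \<and>
      (\<forall>W\<in>\<W>. \<forall>x\<in>topspace X. f x \<in> W \<longleftrightarrow> f0 x \<in> W) \<longrightarrow> f \<in> U)"
  have "generate_topology_on ?S U"
    using U(1) unfolding compact_open_topology_def openin_topology_generated_by_iff .
  then have "f0 \<in> U \<longrightarrow> (\<exists>\<W>. ?good \<W> U)"
  proof induction
    case Empty
    then show ?case by simp
  next
    case (Int a b)
    show ?case
    proof
      assume "f0 \<in> a \<inter> b"
      then have "f0 \<in> a" "f0 \<in> b" by auto
      with Int.IH obtain \<W>a \<W>b where "?good \<W>a a" "?good \<W>b b" by (elim impE exE)
      then have "?good (\<W>a \<union> \<W>b) (a \<inter> b)" by (simp add: ball_Un)
      then show "\<exists>\<W>. ?good \<W> (a \<inter> b)" by blast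
    qed
  next
    case (UN K)
    show ?case
    proof
      assume "f0 \<in> \<Union>K"
      then obtain k where k: "k \<in> K" "f0 \<in> k" by blast
      then obtain \<W> where "?good \<W> k" using UN.IH[OF k(1)] by (elim impE exE)
      then have "?good \<W> (\<Union>K)" using k(1) by (simp only: Union_iff) blast
      then show "\<exists>\<W>. ?good \<W> (\<Union>K)" by blast
    qed
  next
    case (Basis s)
    show ?case
    proof
      assume f0: "f0 \<in> s"
      obtain K V where s: "s = {f \<in> extensional (topspace X). continuous_map X Y f \<and> f ` K \<subseteq> V}"
        and K: "compactin X K" and V: "openin Y V"
        using Basis by blast
      have f0': "continuous_map X Y f0" "f0 ` K \<subseteq> V" using f0 by (simp_all add: s)
      obtain W where W: "openin Y W" "closedin Y W" "f0 ` K \<subseteq> W" "W \<subseteq> V"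
        using clopen_between[OF zd image_compactin[OF K f0'(1)] V f0'(2)] .
      have "f ` K \<subseteq> V" if "\<forall>x\<in>topspace X. f x \<in> W \<longleftrightarrow> f0 x \<in> W" for f
        using that W compactin_subset_topspace[OF K] by blast
      then have "?good {W} s" using W by (simp add: s)
      then show "\<exists>\<W>. ?good \<W> s" by blast
    qed
  qed
  with U(2) obtain \<W> where "?good \<W> U" by (elim impE exE)
  then show thesis by (elim conjE) (rule that)
qed

text \<open>One clopen separator is chosen for each pair of basic open sets that has one. For
  distinct points, a clopen \<open>Z\<close> around the first that omits the second contains a basic
  set around the first, and its complement a basic set around the second; the separator chosen for
  this pair separates the points.\<close>

lemma countable_separating_clopens:
  assumes "zero_dim_space X" "Hausdorff_space X" "second_countable X"
  shows "\<exists>W :: nat \<Rightarrow> 'a set. (\<forall>i. openin X (W i) \<and> closedin X (W i)) \<and>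
    (\<forall>x\<in>topspace X. \<forall>y\<in>topspace X. x \<noteq> y \<longrightarrow> (\<exists>i. x \<in> W i \<and> y \<notin> W i))"
proof -
  obtain \<B> where \<B>: "countable \<B>" "\<And>V. V \<in> \<B> \<Longrightarrow> openin X V"
    "\<And>U x. openin X U \<Longrightarrow> x \<in> U \<Longrightarrow> \<exists>V\<in>\<B>. x \<in> V \<and> V \<subseteq> U"
    using assms(3) unfolding second_countable_def by metis
  define sep where "sep A B W \<longleftrightarrow> openin X W \<and> closedin X W \<and> A \<subseteq> W \<and> B \<inter> W = {}" for A B W
  \<comment> \<open>Inserting the empty set makes \<open>D\<close> nonempty, so that
    \<open>from_nat_into D\<close> enumerates exactly \<open>D\<close>.\<close>
  define D where "D = insert {} ((\<lambda>(A, B). SOME W. sep A B W) ` {(A, B) \<in> \<B> \<times> \<B>. \<exists>W. sep A B W})"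
  have "countable {(A, B) \<in> \<B> \<times> \<B>. \<exists>W. sep A B W}"
    by (rule countable_subset[of _ "\<B> \<times> \<B>"]) (use \<B>(1) in auto)
  then have cD: "countable D"
    unfolding D_def by (intro countable_insert countable_image)
  have clopen: "openin X V \<and> closedin X V" if "V \<in> D" for V
  proof (cases "V = {}")
    case False
    with that obtain A B where "V = (SOME W. sep A B W)" "\<exists>W. sep A B W" by (auto simp: D_def)
    then have "sep A B V" using someI_ex by metis
    then show ?thesis by (simp add: sep_def)
  qed auto
  have ex: "\<exists>V\<in>D. x \<in> V \<and> y \<notin> V" if xy: "x \<in> topspace X" "y \<in> topspace X" "x \<noteq> y" for x y
  proof -
    obtain U U' where "openin X U" "openin X U'" "x \<in> U" "y \<in> U'" "disjnt U U'"
      using assms(2) xy unfolding Hausdorff_space_def by metis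
    then obtain Z where Z: "openin X Z" "closedin X Z" "x \<in> Z" "Z \<subseteq> U" "y \<notin> Z"
      using assms(1) unfolding zero_dim_space_def disjnt_def by blast
    obtain A where A: "A \<in> \<B>" "x \<in> A" "A \<subseteq> Z" using \<B>(3) Z by blast
    obtain B where B: "B \<in> \<B>" "y \<in> B" "B \<subseteq> topspace X - Z"
      using \<B>(3)[of "topspace X - Z" y] Z xy by (auto simp: openin_diff)
    have "sep A B Z" using Z A B by (auto simp: sep_def)
    then have "sep A B (SOME W. sep A B W)" "(SOME W. sep A B W) \<in> D"
      using A B by (auto simp: D_def intro: someI)
    then show ?thesis using A B unfolding sep_def by blast
  qed
  have "D \<noteq> {}" by (auto simp: D_def)
  then have ran: "range (from_nat_into D) = D" using cD by (rule range_from_nat_into)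
  show ?thesis
  proof (rule exI[of _ "from_nat_into D"], rule conjI)
    show "\<forall>i. openin X (from_nat_into D i) \<and> closedin X (from_nat_into D i)"
      using clopen from_nat_into[OF \<open>D \<noteq> {}\<close>] by blast
    have "\<exists>i. x \<in> from_nat_into D i \<and> y \<notin> from_nat_into D i"
      if "x \<in> topspace X" "y \<in> topspace X" "x \<noteq> y" for x y
      using ex[OF that] ran by (metis rangeE)
    then show "\<forall>x\<in>topspace X. \<forall>y\<in>topspace X. x \<noteq> y \<longrightarrow>
        (\<exists>i. x \<in> from_nat_into D i \<and> y \<notin> from_nat_into D i)"
      by blast
  qed
qed


section \<open>Automorphisms\<close>

lemma aut_homeomorphic: "g \<in> aut_set P \<Longrightarrow> homeomorphic_map (top_of P) (top_of P) g"
  by (simp add: aut_set_def homeos_def)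

lemma aut_onto: "g \<in> aut_set P \<Longrightarrow> g ` pts P = pts P"
  using aut_homeomorphic homeomorphic_imp_surjective_map by blast

lemma aut_in: "g \<in> aut_set P \<Longrightarrow> x \<in> pts P \<Longrightarrow> g x \<in> pts P"
  using aut_onto by blast

lemma aut_Bij: "g \<in> aut_set P \<Longrightarrow> g \<in> Bij (pts P)"
  using homeos_subset_Bij by (auto simp: aut_set_def)

lemma epimorphism_aut:
  assumes g: "g \<in> aut_set P"
  shows "epimorphism P P g"
  unfolding epimorphism_def
proof (intro conjI ballI)
  show "continuous_map (top_of P) (top_of P) g"
    using aut_homeomorphic[OF g] by (rule homeomorphic_imp_continuous_map)
  show "g ` pts P = pts P" using g by (rule aut_onto)
  fix x1 x2 assume x: "x1 \<in> pts P" "x2 \<in> pts P"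
  have rel: "(x, y) \<in> rel_of P \<longleftrightarrow> (g x, g y) \<in> rel_of P" if "x \<in> pts P" "y \<in> pts P" for x y
    using g that by (simp add: aut_set_def)
  obtain y1 y2 where "y1 \<in> pts P" "y2 \<in> pts P" "x1 = g y1" "x2 = g y2"
    using x aut_onto[OF g] by (metis imageE)
  then show "(x1, x2) \<in> rel_of P \<longleftrightarrow>
      (\<exists>y1\<in>pts P. \<exists>y2\<in>pts P. g y1 = x1 \<and> g y2 = x2 \<and> (y1, y2) \<in> rel_of P)"
    using rel by metis
qed

lemma aut_mult: "g \<in> aut_set P \<Longrightarrow> h \<in> aut_set P \<Longrightarrow> g \<otimes>\<^bsub>aut_group P\<^esub> h = compose (pts P) g h"
  by (simp add: aut_group_def BijGroup_def aut_Bij)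

text \<open>A continuous bijection of a compact Hausdorff space onto itself is a homeomorphism, and
  by injectivity the related pair that lifts an edge can only be the given one. Restricting yields
  the extensional representative.\<close>

lemma isomorphism_restrict_aut:
  assumes "compact_space (top_of P)" "Hausdorff_space (top_of P)" and iso: "isomorphism P P \<psi>"
  shows "restrict \<psi> (pts P) \<in> aut_set P"
proof -
  have epi: "epimorphism P P \<psi>" and bij: "bij_betw \<psi> (pts P) (pts P)"
    using iso by (auto simp: isomorphism_def)
  have inj: "inj_on \<psi> (pts P)" using bij by (simp add: bij_betw_def)
  have "homeomorphic_map (top_of P) (top_of P) \<psi>"
    by (rule continuous_imp_homeomorphic_map)
      (use assms(1,2) epimorphism_continuous[OF epi] epimorphism_onto[OF epi] inj in auto)
  then have "homeomorphic_map (top_of P) (top_of P) (restrict \<psi> (pts P))"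
    by (rule homeomorphic_map_eq) simp
  moreover have "(x, y) \<in> rel_of P \<longleftrightarrow> (\<psi> x, \<psi> y) \<in> rel_of P" if "x \<in> pts P" "y \<in> pts P" for x y
    using epimorphism_rel_iff[OF epi, of "\<psi> x" "\<psi> y"] epimorphism_image[OF epi] that
      inj_onD[OF inj] by metis
  ultimately show ?thesis by (simp add: aut_set_def homeos_def)
qed

section \<open>Involutions and their conjugates\<close>

lemma invol_apply:
  assumes "h \<in> invol_set P" "x \<in> pts P"
  shows "h (h x) = x"
proof -
  have "h \<in> aut_set P" "h \<otimes>\<^bsub>aut_group P\<^esub> h = \<one>\<^bsub>aut_group P\<^esub>"
    using assms(1) by (auto simp: invol_set_def)
  then have "compose (pts P) h h = (\<lambda>x\<in>pts P. x)"
    by (simp add: aut_mult) (simp add: aut_group_def BijGroup_def)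
  from fun_cong[OF this, of x] show ?thesis using assms(2) by (simp add: compose_def)
qed

text \<open>As \<open>h\<close> is its own inverse, continuity of the inverse and reflection of the
  relation follow from the corresponding facts about \<open>h\<close>.\<close>

lemma invol_setI:
  assumes ext: "h \<in> extensional (pts P)" and cont: "continuous_map (top_of P) (top_of P) h"
    and inv: "\<And>x. x \<in> pts P \<Longrightarrow> h (h x) = x"
    and rel: "\<And>x y. x \<in> pts P \<Longrightarrow> y \<in> pts P \<Longrightarrow> (x, y) \<in> rel_of P \<Longrightarrow> (h x, h y) \<in> rel_of P"
  shows "h \<in> invol_set P"
proof -
  have im: "h x \<in> pts P" if "x \<in> pts P" for x
    using cont that by (auto simp: continuous_map_def)
  have "homeomorphic_maps (top_of P) (top_of P) h h"
    using cont inv by (simp add: homeomorphic_maps_def)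
  then have "homeomorphic_map (top_of P) (top_of P) h"
    using homeomorphic_map_maps by blast
  moreover have "(x, y) \<in> rel_of P \<longleftrightarrow> (h x, h y) \<in> rel_of P" if "x \<in> pts P" "y \<in> pts P" for x y
    using rel[OF that] rel[OF im[OF that(1)] im[OF that(2)]] inv that by auto
  ultimately have aut: "h \<in> aut_set P" using ext by (simp add: aut_set_def homeos_def)
  have "compose (pts P) h h = (\<lambda>x\<in>pts P. x)"
    by (auto simp: compose_def inv intro!: restrict_ext)
  then have "h \<otimes>\<^bsub>aut_group P\<^esub> h = \<one>\<^bsub>aut_group P\<^esub>"
    by (simp add: aut_mult aut) (simp add: aut_group_def BijGroup_def)
  with aut show ?thesis by (simp add: invol_set_def)
qed

text \<open>Evaluation at \<open>g x\<close> avoids the inverse function: multiplying the conjugate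
  by \<open>g\<close> on the right leaves the product of \<open>g\<close> and
  \<open>h\<close>.\<close>

lemma conj_action_apply:
  assumes g: "g \<in> aut_set P" and h: "h \<in> invol_set P" and x: "x \<in> pts P"
  shows "conj_action P g h (g x) = g (h x)"
proof -
  interpret G: group "aut_group P" by (rule group_aut_group)
  let ?f = "conj_action P g h"
  have ha: "h \<in> aut_set P" using h by (simp add: invol_set_def)
  have f: "?f = g \<otimes>\<^bsub>aut_group P\<^esub> h \<otimes>\<^bsub>aut_group P\<^esub> inv\<^bsub>aut_group P\<^esub> g"
    using h by (simp add: conj_action_def)
  have car: "g \<in> carrier (aut_group P)" "h \<in> carrier (aut_group P)"
    using g ha by (simp_all add: carrier_aut_group)
  then have "?f \<in> aut_set P" unfolding f carrier_aut_group[symmetric] by simp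
  moreover have "?f \<otimes>\<^bsub>aut_group P\<^esub> g = g \<otimes>\<^bsub>aut_group P\<^esub> h"
    unfolding f using car by (simp add: G.m_assoc)
  ultimately have "compose (pts P) ?f g = compose (pts P) g h"
    using g ha by (simp add: aut_mult)
  from fun_cong[OF this, of x] show ?thesis using x by (simp add: compose_def)
qed


text \<open>An inverse sequence of finite quotients whose bonding maps are left implicit: inclusion
  of fibres says that they exist, and the last clause says that they commute with the reflections.
  The sets \<open>W i\<close> make the sequence separate points, and the divisibility lets every
  \<open>[q]\<close> with \<open>q \<ge> 1\<close> appear as a quotient of some level.\<close>

definition flip_tower ::
    "'a rstruct \<Rightarrow> (nat \<Rightarrow> 'a set) \<Rightarrow> (nat \<Rightarrow> nat) \<Rightarrow> (nat \<Rightarrow> 'a \<Rightarrow> nat) \<Rightarrow> bool" where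
  "flip_tower P W m \<theta> \<longleftrightarrow>
    (\<forall>i. m i \<ge> 1 \<and> epimorphism P (linear_graph (m i)) (\<theta> i)) \<and>
    (\<forall>i. Suc i dvd m (Suc i) \<and>
      (\<forall>x\<in>pts P. \<forall>y\<in>pts P. \<theta> (Suc i) x = \<theta> (Suc i) y \<longrightarrow>
        \<theta> i x = \<theta> i y \<and> (x \<in> W i \<longleftrightarrow> y \<in> W i)) \<and>
      (\<forall>x\<in>pts P. \<forall>y\<in>pts P. \<theta> (Suc i) y = flip (m (Suc i)) (\<theta> (Suc i) x) \<longrightarrow>
        \<theta> i y = flip (m i) (\<theta> i x)))"

section \<open>Chain maps of the projective Fraisse limit\<close>

context
  fixes P :: "'a rstruct"
  assumes P: "projective_Fraisse_limit P"
begin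

lemma limit_topological:
  "compact_space (top_of P)" "Hausdorff_space (top_of P)" "zero_dim_space (top_of P)"
  "second_countable (top_of P)" "closedin (prod_topology (top_of P) (top_of P)) (rel_of P)"
proof -
  have "topological_rstruct P"
    using P unfolding projective_Fraisse_limit_def by (elim conjE)
  then show "compact_space (top_of P)" "Hausdorff_space (top_of P)" "zero_dim_space (top_of P)"
    "second_countable (top_of P)" "closedin (prod_topology (top_of P) (top_of P)) (rel_of P)"
    by (simp_all add: topological_rstruct_def)
qed

lemma limit_epimorphism:
  assumes "n \<ge> 1"
  obtains \<phi> where "epimorphism P (linear_graph n) \<phi>"
proof -
  have "\<forall>A\<in>linear_graphs. \<exists>\<phi>. epimorphism P A \<phi>"
    using P unfolding projective_Fraisse_limit_def by (elim conjE)
  then show thesis using assms that by (auto simp: linear_graphs_def)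
qed

lemma limit_homogeneous:
  assumes "n \<ge> 1" "epimorphism P (linear_graph n) \<phi>1" "epimorphism P (linear_graph n) \<phi>2"
  obtains g where "g \<in> aut_set P" "\<And>x. x \<in> pts P \<Longrightarrow> \<phi>2 x = \<phi>1 (g x)"
proof -
  have "\<forall>A\<in>linear_graphs. \<forall>\<phi>1 \<phi>2. epimorphism P A \<phi>1 \<and> epimorphism P A \<phi>2 \<longrightarrow>
        (\<exists>\<psi>. isomorphism P P \<psi> \<and> (\<forall>x\<in>pts P. \<phi>2 x = \<phi>1 (\<psi> x)))"
    using P unfolding projective_Fraisse_limit_def by (elim conjE)
  moreover have "linear_graph n \<in> linear_graphs" using assms(1) by (auto simp: linear_graphs_def)
  ultimately obtain \<psi> where \<psi>: "isomorphism P P \<psi>" "\<forall>x\<in>pts P. \<phi>2 x = \<phi>1 (\<psi> x)"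
    using assms(2,3) by blast
  show thesis
    by (rule that[OF isomorphism_restrict_aut[OF limit_topological(1,2) \<psi>(1)]]) (simp add: \<psi>(2))
qed

section \<open>Refining and lifting epimorphisms\<close>

lemma refine_clopens:
  assumes "finite \<W>" "\<forall>W\<in>\<W>. openin (top_of P) W \<and> closedin (top_of P) W"
  obtains n \<phi> where "n \<ge> 1" "epimorphism P (linear_graph n) \<phi>"
    "\<forall>W\<in>\<W>. \<forall>x\<in>pts P. \<forall>y\<in>pts P. \<phi> x = \<phi> y \<longrightarrow> (x \<in> W \<longleftrightarrow> y \<in> W)"
proof -
  let ?t = "\<lambda>x. {W \<in> \<W>. x \<in> W}"
  obtain A \<phi> f0 where A: "A \<in> linear_graphs" "epimorphism P A \<phi>" "\<forall>x\<in>pts P. ?t x = f0 (\<phi> x)"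
    using limit_factor_any_type[OF P finite_Pow_iff[THEN iffD2, OF assms(1)]
        continuous_map_clopen_type[OF assms]] by blast
  obtain n where n: "n \<ge> 1" "A = linear_graph n" using A(1) by (auto simp: linear_graphs_def)
  show thesis
  proof (rule that[OF n(1)])
    show "epimorphism P (linear_graph n) \<phi>" using A(2) n(2) by simp
    have "x \<in> W \<longleftrightarrow> y \<in> W" if "W \<in> \<W>" "x \<in> pts P" "y \<in> pts P" "\<phi> x = \<phi> y" for W x y
      using that A(3) by (metis (mono_tags, lifting) mem_Collect_eq)
    then show "\<forall>W\<in>\<W>. \<forall>x\<in>pts P. \<forall>y\<in>pts P. \<phi> x = \<phi> y \<longrightarrow> (x \<in> W \<longleftrightarrow> y \<in> W)"
      by blast
  qed
qed

lemma refine_epimorphism: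
  assumes \<theta>: "epimorphism P (linear_graph m) \<theta>"
    and \<W>: "finite \<W>" "\<forall>W\<in>\<W>. openin (top_of P) W \<and> closedin (top_of P) W"
  obtains n \<phi> g where "n \<ge> 1" "epimorphism P (linear_graph n) \<phi>"
    "epimorphism (linear_graph n) (linear_graph m) g" "\<forall>x\<in>pts P. \<theta> x = g (\<phi> x)"
    "\<forall>W\<in>\<W>. \<forall>x\<in>pts P. \<forall>y\<in>pts P. \<phi> x = \<phi> y \<longrightarrow> (x \<in> W \<longleftrightarrow> y \<in> W)"
proof -
  \<comment> \<open>Adding the fibres of \<theta> to the clopen family forces \<theta> to be
    constant on the fibres of \<phi>, hence to factor through \<phi>.\<close>
  let ?F = "(\<lambda>i. {x \<in> pts P. \<theta> x = i}) ` {1..m}"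
  have fin: "finite (\<W> \<union> ?F)" using \<W>(1) by simp
  have clopen: "\<forall>W\<in>\<W> \<union> ?F. openin (top_of P) W \<and> closedin (top_of P) W"
    using \<W>(2) fibre_clopen[OF \<theta>] by auto
  obtain n \<phi> where n: "n \<ge> 1" and \<phi>: "epimorphism P (linear_graph n) \<phi>"
    and sat: "\<forall>W\<in>\<W> \<union> ?F. \<forall>x\<in>pts P. \<forall>y\<in>pts P. \<phi> x = \<phi> y \<longrightarrow> (x \<in> W \<longleftrightarrow> y \<in> W)"
    using refine_clopens[OF fin clopen] .
  have fib: "\<theta> x = \<theta> y" if xy: "x \<in> pts P" "y \<in> pts P" "\<phi> x = \<phi> y" for x y
  proof -
    have "{z \<in> pts P. \<theta> z = \<theta> x} \<in> \<W> \<union> ?F"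
      using epimorphism_image[OF \<theta> xy(1)] by auto
    from bspec[OF bspec[OF bspec[OF sat this] xy(1)] xy(2)] show ?thesis using xy by simp
  qed
  obtain g where "epimorphism (linear_graph n) (linear_graph m) g" "\<And>x. x \<in> pts P \<Longrightarrow> \<theta> x = g (\<phi> x)"
    using epimorphism_factor[OF \<phi> \<theta> fib] by blast
  then show thesis using that[OF n \<phi>] sat by blast
qed

text \<open>Homogeneity gives the lifting property: for any \<eta> onto \<open>[m]\<close>, the maps
  \<open>k \<circ> \<eta>\<close> and \<phi> differ by an automorphism \<open>g\<close>, and
  \<open>\<eta> \<circ> g\<close> is the lift.\<close>

lemma lift_epimorphism:
  assumes "m \<ge> 1" "n \<ge> 1" and k: "epimorphism (linear_graph m) (linear_graph n) k"
    and \<phi>: "epimorphism P (linear_graph n) \<phi>"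
  obtains \<theta> where "epimorphism P (linear_graph m) \<theta>" "\<And>x. x \<in> pts P \<Longrightarrow> \<phi> x = k (\<theta> x)"
proof -
  obtain \<eta> where \<eta>: "epimorphism P (linear_graph m) \<eta>" using limit_epimorphism[OF assms(1)] .
  obtain g where g: "g \<in> aut_set P" "\<And>x. x \<in> pts P \<Longrightarrow> \<phi> x = (k \<circ> \<eta>) (g x)"
    using limit_homogeneous[OF assms(2) epimorphism_compose[OF \<eta> k] \<phi>] by blast
  show thesis
    by (rule that[OF epimorphism_compose[OF epimorphism_aut[OF g(1)] \<eta>]]) (simp add: g(2))
qed

text \<open>A common refinement \<xi> of both maps turns them into walks \<open>a1\<close> and
  \<open>a2\<close> on one path \<open>[l]\<close>, to which the symmetric walk applies.
  Surjectivity of \<xi> translates its indices back into points of the limit.\<close>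

lemma symmetric_chain:
  assumes "n \<ge> 1" and \<phi>1: "epimorphism P (linear_graph n) \<phi>1" and \<phi>2: "epimorphism P (linear_graph n) \<phi>2"
  obtains m k where "m \<ge> 1" "epimorphism (linear_graph m) (linear_graph n) k"
    "\<And>c. c \<in> {1..m} \<Longrightarrow> \<exists>x\<in>pts P.
      (k c, k (flip m c)) = (\<phi>1 x, \<phi>2 x) \<or> (k c, k (flip m c)) = (\<phi>2 x, \<phi>1 x)"
proof -
  have fin: "finite ((\<lambda>i. {x \<in> pts P. \<phi>2 x = i}) ` {1..n})" by simp
  have clopen: "\<forall>W\<in>(\<lambda>i. {x \<in> pts P. \<phi>2 x = i}) ` {1..n}. openin (top_of P) W \<and> closedin (top_of P) W"
    using fibre_clopen[OF \<phi>2] by auto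
  obtain l \<xi> a1 where "l \<ge> 1" and \<xi>: "epimorphism P (linear_graph l) \<xi>"
    and a1: "epimorphism (linear_graph l) (linear_graph n) a1" "\<forall>x\<in>pts P. \<phi>1 x = a1 (\<xi> x)"
    and sat: "\<forall>W\<in>(\<lambda>i. {x \<in> pts P. \<phi>2 x = i}) ` {1..n}.
      \<forall>x\<in>pts P. \<forall>y\<in>pts P. \<xi> x = \<xi> y \<longrightarrow> (x \<in> W \<longleftrightarrow> y \<in> W)"
    using refine_epimorphism[OF \<phi>1 fin clopen] .
  have fib: "\<phi>2 x = \<phi>2 y" if xy: "x \<in> pts P" "y \<in> pts P" "\<xi> x = \<xi> y" for x y
  proof -
    have "{z \<in> pts P. \<phi>2 z = \<phi>2 x} \<in> (\<lambda>i. {x \<in> pts P. \<phi>2 x = i}) ` {1..n}"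
      using epimorphism_image[OF \<phi>2 xy(1)] by auto
    from bspec[OF bspec[OF bspec[OF sat this] xy(1)] xy(2)] show ?thesis using xy by simp
  qed
  obtain a2 where a2: "epimorphism (linear_graph l) (linear_graph n) a2" "\<And>x. x \<in> pts P \<Longrightarrow> \<phi>2 x = a2 (\<xi> x)"
    using epimorphism_factor[OF \<xi> \<phi>2 fib] by blast
  obtain m k where m: "m \<ge> 1" and k: "epimorphism (linear_graph m) (linear_graph n) k"
    and sym: "\<And>c. c \<in> {1..m} \<Longrightarrow>
      \<exists>i\<in>{1..l}. (k c, k (flip m c)) = (a1 i, a2 i) \<or> (k c, k (flip m c)) = (a2 i, a1 i)"
    using symmetric_walk[OF a1(1) a2(1) assms(1)] by blast
  show thesis
  proof (rule that[OF m k])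
    fix c assume "c \<in> {1..m}"
    then obtain i where i: "i \<in> {1..l}"
      "(k c, k (flip m c)) = (a1 i, a2 i) \<or> (k c, k (flip m c)) = (a2 i, a1 i)"
      using sym by blast
    then have "i \<in> pts (linear_graph l)" by simp
    then obtain x where "x \<in> pts P" "\<xi> x = i" using epimorphism_surj[OF \<xi>] by blast
    then show "\<exists>x\<in>pts P.
      (k c, k (flip m c)) = (\<phi>1 x, \<phi>2 x) \<or> (k c, k (flip m c)) = (\<phi>2 x, \<phi>1 x)"
      using i(2) a1(2) a2(2) by metis
  qed
qed

text \<open>Write \<open>\<theta> = g \<circ> \<phi>\<close> with \<open>\<phi>\<close> fine.  By homogeneity \<open>flip m \<circ> \<theta> = \<theta> \<circ> \<psi>\<close> for an
  automorphism \<open>\<psi>\<close>, and a symmetric chain \<open>k\<close> for \<open>\<phi> \<circ> \<psi>\<close> and \<open>\<phi>\<close> makes \<open>g \<circ> k\<close> commute with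
  the flips.\<close>

lemma flip_refinement:
  assumes "m \<ge> 1" "q \<ge> 1" and \<theta>: "epimorphism P (linear_graph m) \<theta>"
    and W: "openin (top_of P) W" "closedin (top_of P) W"
  obtains m' \<theta>' where "m' \<ge> 1" "q dvd m'" "epimorphism P (linear_graph m') \<theta>'"
    "\<And>x y. x \<in> pts P \<Longrightarrow> y \<in> pts P \<Longrightarrow> \<theta>' x = \<theta>' y \<Longrightarrow> \<theta> x = \<theta> y \<and> (x \<in> W \<longleftrightarrow> y \<in> W)"
    "\<And>x y. x \<in> pts P \<Longrightarrow> y \<in> pts P \<Longrightarrow> \<theta>' y = flip m' (\<theta>' x) \<Longrightarrow> \<theta> y = flip m (\<theta> x)"
proof -
  obtain b \<phi> g where b: "b \<ge> 1" and \<phi>: "epimorphism P (linear_graph b) \<phi>"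
    and g: "epimorphism (linear_graph b) (linear_graph m) g" and g_eq: "\<forall>x\<in>pts P. \<theta> x = g (\<phi> x)"
    and sat: "\<forall>W'\<in>{W}. \<forall>x\<in>pts P. \<forall>y\<in>pts P. \<phi> x = \<phi> y \<longrightarrow> (x \<in> W' \<longleftrightarrow> y \<in> W')"
    using refine_epimorphism[OF \<theta>, of "{W}"] W by auto
  obtain \<psi> where \<psi>: "\<psi> \<in> aut_set P" "\<And>x. x \<in> pts P \<Longrightarrow> (flip m \<circ> \<theta>) x = \<theta> (\<psi> x)"
    using limit_homogeneous[OF assms(1) \<theta> epimorphism_compose[OF \<theta> epimorphism_flip]] by blast
  obtain l k where l: "l \<ge> 1" and k: "epimorphism (linear_graph l) (linear_graph b) k"
    and sym: "\<And>c. c \<in> {1..l} \<Longrightarrow> \<exists>x\<in>pts P. (k c, k (flip l c)) = ((\<phi> \<circ> \<psi>) x, \<phi> x) \<or>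
      (k c, k (flip l c)) = (\<phi> x, (\<phi> \<circ> \<psi>) x)"
    using symmetric_chain[OF b epimorphism_compose[OF epimorphism_aut[OF \<psi>(1)] \<phi>] \<phi>] by blast
  have equi: "g (k (flip l c)) = flip m (g (k c))" if c: "c \<in> {1..l}" for c
  proof -
    obtain x where x: "x \<in> pts P"
      "(k c, k (flip l c)) = ((\<phi> \<circ> \<psi>) x, \<phi> x) \<or> (k c, k (flip l c)) = (\<phi> x, (\<phi> \<circ> \<psi>) x)"
      using sym[OF c] by blast
    \<comment> \<open>The choice of \<psi> makes \<open>g\<close> send the two entries of such a
      pair to mutually reflected vertices; the opposite order of the pair is handled by reflecting
      twice.\<close>
    have "g (\<phi> (\<psi> x)) = flip m (g (\<phi> x))"
      using \<psi>(2)[OF x(1)] bspec[OF g_eq x(1)] bspec[OF g_eq aut_in[OF \<psi>(1) x(1)]] by simp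
    moreover have "flip m (flip m (g (\<phi> x))) = g (\<phi> x)"
      using epimorphism_image[OF \<theta> x(1)] bspec[OF g_eq x(1)] by simp
    ultimately show ?thesis using x(2) by auto
  qed
  have lq: "l * q \<ge> 1" using l assms(2) by simp
  \<comment> \<open>Subdividing each vertex of \<open>[l]\<close> into \<open>q\<close> vertices
    secures divisibility by \<open>q\<close> and keeps equivariance, by
    \<open>block_flip\<close>.\<close>
  obtain \<theta>' where \<theta>': "epimorphism P (linear_graph (l * q)) \<theta>'"
    "\<And>x. x \<in> pts P \<Longrightarrow> \<phi> x = (k \<circ> block q) (\<theta>' x)"
    using lift_epimorphism[OF lq b epimorphism_compose[OF epimorphism_block[OF assms(2)] k] \<phi>] by blast
  have \<theta>_eq: "\<theta> x = g (k (block q (\<theta>' x)))" if "x \<in> pts P" for x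
    using bspec[OF g_eq that] \<theta>'(2)[OF that] by simp
  show thesis
  proof (rule that[OF lq _ \<theta>'(1)])
    show "q dvd l * q" by simp
    fix x y assume xy: "x \<in> pts P" "y \<in> pts P"
    show "\<theta> x = \<theta> y \<and> (x \<in> W \<longleftrightarrow> y \<in> W)" if "\<theta>' x = \<theta>' y"
    proof -
      have "\<phi> x = \<phi> y" using \<theta>'(2)[OF xy(1)] \<theta>'(2)[OF xy(2)] that by simp
      moreover have "\<theta> x = \<theta> y" using \<theta>_eq[OF xy(1)] \<theta>_eq[OF xy(2)] that by simp
      ultimately show ?thesis using sat xy by blast
    qed
    assume flip: "\<theta>' y = flip (l * q) (\<theta>' x)"
    have in1: "\<theta>' x \<in> {1..l * q}" using epimorphism_image[OF \<theta>'(1) xy(1)] by simp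
    then have in2: "block q (\<theta>' x) \<in> {1..l}"
      using epimorphism_image[OF epimorphism_block[OF assms(2), of l], of "\<theta>' x"] by simp
    have "\<theta> y = g (k (flip l (block q (\<theta>' x))))"
      using \<theta>_eq[OF xy(2)] flip block_flip[OF assms(2) in1] by simp
    also have "\<dots> = flip m (\<theta> x)"
      using equi[OF in2] \<theta>_eq[OF xy(1)] by simp
    finally show "\<theta> y = flip m (\<theta> x)" .
  qed
qed

section \<open>The tower of reflections and its limit involution\<close>

lemma flip_tower_exists:
  assumes W: "\<forall>i. openin (top_of P) (W i) \<and> closedin (top_of P) (W i)"
  shows "\<exists>m \<theta>. flip_tower P W m \<theta>"
proof -
  let ?S = "\<lambda>(i::nat) p. fst p \<ge> (1::nat) \<and> epimorphism P (linear_graph (fst p)) (snd p)"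
  let ?R = "\<lambda>i p p'. Suc i dvd fst p' \<and>
    (\<forall>x\<in>pts P. \<forall>y\<in>pts P. snd p' x = snd p' y \<longrightarrow> snd p x = snd p y \<and> (x \<in> W i \<longleftrightarrow> y \<in> W i)) \<and>
    (\<forall>x\<in>pts P. \<forall>y\<in>pts P. snd p' y = flip (fst p') (snd p' x) \<longrightarrow> snd p y = flip (fst p) (snd p x))"
  \<comment> \<open>The recursion starts from the one-vertex graph; stage \<open>i\<close> is then
    refined by \<open>flip_refinement\<close> with divisor \<open>Suc i\<close> and clopen set
    \<open>W i\<close>.\<close>
  obtain \<phi> where \<phi>: "epimorphism P (linear_graph 1) \<phi>" using limit_epimorphism[of 1] by auto
  have "\<exists>f. \<forall>i. ?S i (f i) \<and> ?R i (f i) (f (Suc i))"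
  proof (rule dependent_nat_choice[of ?S ?R])
    show "\<exists>p. ?S 0 p" using \<phi> by (intro exI[of _ "(1, \<phi>)"]) simp
    fix p i assume "?S i p"
    then have p: "1 \<le> fst p" "1 \<le> Suc i" "epimorphism P (linear_graph (fst p)) (snd p)" by simp_all
    obtain m' \<theta>' where r: "m' \<ge> 1" "Suc i dvd m'" "epimorphism P (linear_graph m') \<theta>'"
      "\<And>x y. x \<in> pts P \<Longrightarrow> y \<in> pts P \<Longrightarrow> \<theta>' x = \<theta>' y \<Longrightarrow> snd p x = snd p y \<and> (x \<in> W i \<longleftrightarrow> y \<in> W i)"
      "\<And>x y. x \<in> pts P \<Longrightarrow> y \<in> pts P \<Longrightarrow> \<theta>' y = flip m' (\<theta>' x) \<Longrightarrow> snd p y = flip (fst p) (snd p x)"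
      by (rule flip_refinement[OF p W[rule_format, THEN conjunct1] W[rule_format, THEN conjunct2]]) (rule that)
    have "?S (Suc i) (m', \<theta>')" using r(1,3) by simp
    moreover have "?R i p (m', \<theta>')"
      unfolding fst_conv snd_conv using r(2,4,5) by blast
    ultimately have "?S (Suc i) (m', \<theta>') \<and> ?R i p (m', \<theta>')" by (rule conjI)
    then show "\<exists>p'. ?S (Suc i) p' \<and> ?R i p p'" by (rule exI[of _ "(m', \<theta>')"])
  qed
  then obtain f where f: "\<forall>i. ?S i (f i) \<and> ?R i (f i) (f (Suc i))" ..
  then have "flip_tower P W (\<lambda>i. fst (f i)) (\<lambda>i. snd (f i))"
    unfolding flip_tower_def by blast
  then show ?thesis by blast
qed

text \<open>The levels of a tower separate points, and the reflections of the coordinates of a point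
  are again coherent, so compactness provides a point with the reflected coordinates. This defines
  \<open>h\<close>, whose continuity and compatibility with the relation are checked level by
  level.\<close>

lemma universal_involution:
  obtains h where "h \<in> invol_set P"
    "\<And>q. q \<ge> 1 \<Longrightarrow> \<exists>\<theta>. epimorphism P (linear_graph q) \<theta> \<and> (\<forall>x\<in>pts P. \<theta> (h x) = flip q (\<theta> x))"
proof -
  obtain W :: "nat \<Rightarrow> 'a set" where W': "(\<forall>i. openin (top_of P) (W i) \<and> closedin (top_of P) (W i)) \<and>
      (\<forall>x\<in>pts P. \<forall>y\<in>pts P. x \<noteq> y \<longrightarrow> (\<exists>i. x \<in> W i \<and> y \<notin> W i))"
    using countable_separating_clopens[OF limit_topological(3,2,4)] ..
  note sep = W'[THEN conjunct2]
  obtain m \<theta> where tower: "flip_tower P W m \<theta>"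
    using flip_tower_exists[OF W'[THEN conjunct1]] by blast
  have \<theta>: "epimorphism P (linear_graph (m i)) (\<theta> i)" and m: "m i \<ge> 1" "Suc i dvd m (Suc i)" for i
    using tower unfolding flip_tower_def by blast+
  have fib: "\<theta> i x = \<theta> i y \<and> (x \<in> W i \<longleftrightarrow> y \<in> W i)"
    if "x \<in> pts P" "y \<in> pts P" "\<theta> (Suc i) x = \<theta> (Suc i) y" for i x y
    using tower that unfolding flip_tower_def by blast
  have flp: "\<theta> i y = flip (m i) (\<theta> i x)"
    if "x \<in> pts P" "y \<in> pts P" "\<theta> (Suc i) y = flip (m (Suc i)) (\<theta> (Suc i) x)" for i x y
    using tower that unfolding flip_tower_def by blast
  have \<theta>_in: "\<theta> i x \<in> {1..m i}" if "x \<in> pts P" for i x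
    using epimorphism_image[OF \<theta> that] by simp
  have fib_mono: "\<theta> i x = \<theta> i y" if "i \<le> j" "x \<in> pts P" "y \<in> pts P" "\<theta> j x = \<theta> j y" for i j x y
    using that by (induction rule: inc_induct) (use fib in blast)+
  have inj: "x = y" if xy: "x \<in> pts P" "y \<in> pts P" "\<And>i. \<theta> i x = \<theta> i y" for x y
    using sep xy(1,2) fib[OF xy(1,2) xy(3)] by blast
  \<comment> \<open>The fibres around \<open>x\<close> are closed, decreasing and meet only in
    \<open>x\<close>; if each of them left \<open>U\<close>, compactness would produce a second
    common point.\<close>
  have small_fibre: "\<exists>i. \<forall>y\<in>pts P. \<theta> i y = \<theta> i x \<longrightarrow> y \<in> U"
    if x: "x \<in> pts P" and U: "openin (top_of P) U" "x \<in> U" for x U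
  proof (rule ccontr)
    assume no: "\<not> ?thesis"
    define C where "C i = {y \<in> pts P. \<theta> i y = \<theta> i x} - U" for i
    have "closedin (top_of P) (C i)" for i
      unfolding C_def using fibre_clopen(2)[OF \<theta>] U(1) by (rule closedin_diff)
    moreover have "C i \<noteq> {}" for i using no by (auto simp: C_def)
    moreover have "decseq C"
      unfolding decseq_Suc_iff C_def using fib[OF _ x] by blast
    ultimately have "(\<Inter>i. C i) \<noteq> {}" by (rule compact_space_imp_nest[OF limit_topological(1)])
    then obtain y where "\<And>i. y \<in> C i" by blast
    then have "y \<in> pts P" "y \<notin> U" "\<And>i. \<theta> i y = \<theta> i x" by (auto simp: C_def)
    with inj x U(2) show False by metis
  qed
  have "\<exists>y\<in>pts P. \<forall>i. \<theta> i y = flip (m i) (\<theta> i x)" if x: "x \<in> pts P" for x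
  proof -
    define C where "C i = {y \<in> pts P. \<theta> i y = flip (m i) (\<theta> i x)}" for i
    have "closedin (top_of P) (C i)" for i
      unfolding C_def by (rule fibre_clopen(2)[OF \<theta>])
    moreover have "C i \<noteq> {}" for i
    proof -
      have "flip (m i) (\<theta> i x) \<in> pts (linear_graph (m i))"
        using flip_in[OF \<theta>_in[OF x]] by (simp only: top_linear_graph topspace_discrete_topology)
      then show ?thesis using epimorphism_surj[OF \<theta>[of i]] by (auto simp: C_def)
    qed
    moreover have "decseq C"
      unfolding decseq_Suc_iff C_def using flp[OF x] by blast
    ultimately have "(\<Inter>i. C i) \<noteq> {}" by (rule compact_space_imp_nest[OF limit_topological(1)])
    then show ?thesis by (auto simp: C_def)
  qed
  then obtain h0 where h0: "\<And>x. x \<in> pts P \<Longrightarrow> h0 x \<in> pts P"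
    "\<And>x i. x \<in> pts P \<Longrightarrow> \<theta> i (h0 x) = flip (m i) (\<theta> i x)"
    by metis
  define h where "h = restrict h0 (pts P)"
  have h: "h x \<in> pts P" "\<theta> i (h x) = flip (m i) (\<theta> i x)" if "x \<in> pts P" for x i
    using h0 that by (simp_all add: h_def)
  \<comment> \<open>The relation is determined by the levels because it is closed: an unrelated pair
    has an open box missing the relation, and some level has both fibres inside the box, yet the
    edge at that level lifts to a related pair in these fibres.\<close>
  have rel: "(x, y) \<in> rel_of P"
    if xy: "x \<in> pts P" "y \<in> pts P" and r: "\<And>i. (\<theta> i x, \<theta> i y) \<in> rel_of (linear_graph (m i))" for x y
  proof (rule ccontr)
    assume "(x, y) \<notin> rel_of P"
    moreover have "openin (prod_topology (top_of P) (top_of P)) (pts P \<times> pts P - rel_of P)"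
      using limit_topological(5) by (simp add: closedin_def)
    ultimately obtain U V where UV: "openin (top_of P) U" "openin (top_of P) V" "x \<in> U" "y \<in> V"
      "U \<times> V \<subseteq> pts P \<times> pts P - rel_of P"
      using xy unfolding openin_prod_topology_alt by (metis DiffI SigmaI)
    obtain i where i: "\<forall>z\<in>pts P. \<theta> i z = \<theta> i x \<longrightarrow> z \<in> U" using small_fibre xy UV by blast
    obtain j where j: "\<forall>z\<in>pts P. \<theta> j z = \<theta> j y \<longrightarrow> z \<in> V" using small_fibre xy UV by blast
    define t where "t = max i j"
    have "\<theta> t x \<in> pts (linear_graph (m t))" "\<theta> t y \<in> pts (linear_graph (m t))"
      using \<theta>_in xy by simp_all
    then obtain x' y' where xy': "x' \<in> pts P" "y' \<in> pts P" "\<theta> t x' = \<theta> t x" "\<theta> t y' = \<theta> t y"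
      "(x', y') \<in> rel_of P"
      using epimorphism_lift_rel[OF \<theta> _ _ r] by metis
    have "x' \<in> U" "y' \<in> V"
      using i j xy xy' fib_mono[of i t x' x] fib_mono[of j t y' y] by (auto simp: t_def)
    with xy'(5) UV(5) show False by blast
  qed
  have invol: "h \<in> invol_set P"
  proof (rule invol_setI)
    show "h \<in> extensional (pts P)" by (simp add: h_def)
    show "continuous_map (top_of P) (top_of P) h"
      unfolding continuous_map_def
    proof (intro conjI allI impI)
      show "h \<in> pts P \<rightarrow> pts P" using h by blast
      fix U assume U: "openin (top_of P) U"
      show "openin (top_of P) {x \<in> pts P. h x \<in> U}"
      proof (subst openin_subopen, rule ballI)
        fix x assume "x \<in> {x \<in> pts P. h x \<in> U}"
        then have x: "x \<in> pts P" "h x \<in> U" by auto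
        obtain i where i: "\<forall>y\<in>pts P. \<theta> i y = \<theta> i (h x) \<longrightarrow> y \<in> U"
          using small_fibre[OF h(1)[OF x(1)] U x(2)] by blast
        have "{y \<in> pts P. \<theta> i y = \<theta> i x} \<subseteq> {x \<in> pts P. h x \<in> U}"
          using i h x(1) by auto
        then show "\<exists>T. openin (top_of P) T \<and> x \<in> T \<and> T \<subseteq> {x \<in> pts P. h x \<in> U}"
          using fibre_clopen(1)[OF \<theta>, of i "\<theta> i x"] x(1)
          by (intro exI[of _ "{y \<in> pts P. \<theta> i y = \<theta> i x}"]) auto
      qed
    qed
    show "h (h x) = x" if x: "x \<in> pts P" for x
      using h[OF x] h[OF h(1)[OF x]] flip_flip[OF \<theta>_in[OF x]] x by (intro inj) simp_all
    fix x y assume xy: "x \<in> pts P" "y \<in> pts P" "(x, y) \<in> rel_of P"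
    show "(h x, h y) \<in> rel_of P"
    proof (rule rel)
      show "h x \<in> pts P" "h y \<in> pts P" using h xy by simp_all
      fix i
      show "(\<theta> i (h x), \<theta> i (h y)) \<in> rel_of (linear_graph (m i))"
        using epimorphism_rel[OF \<theta> xy] flip_rel_iff[OF \<theta>_in \<theta>_in] h xy by simp
    qed
  qed
  show thesis
  proof (rule that[OF invol])
    fix q :: nat assume "q \<ge> 1"
    \<comment> \<open>Level \<open>q\<close> has a number of vertices divisible by \<open>q\<close>,
      by the divisibility clause at index \<open>q - 1\<close>; blocks of length \<open>t\<close>
      then map it equivariantly onto \<open>[q]\<close>.\<close>
    then obtain t where t: "m q = q * t" using m(2)[of "q - 1"] by auto
    then have "t \<ge> 1" using m(1)[of q] by (cases t) auto
    have "epimorphism P (linear_graph q) (block t \<circ> \<theta> q)"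
      using epimorphism_compose[OF \<theta>[of q, unfolded t] epimorphism_block[OF \<open>t \<ge> 1\<close>]] .
    moreover have "(block t \<circ> \<theta> q) (h x) = flip q ((block t \<circ> \<theta> q) x)" if "x \<in> pts P" for x
      using h[OF that] block_flip[OF \<open>t \<ge> 1\<close> \<theta>_in[OF that, of q, unfolded t]] by (simp add: t)
    ultimately show "\<exists>\<theta>. epimorphism P (linear_graph q) \<theta> \<and> (\<forall>x\<in>pts P. \<theta> (h x) = flip q (\<theta> x))"
      by blast
  qed
qed

text \<open>Only the set of pairs \<open>(\<phi> x, \<phi> (h x))\<close> matters, and one inclusion
  between such sets is enough: \<phi> is so fine that finitely many clopen sets describing a
  neighbourhood, and also their preimages under \<open>h\<close>, are unions of fibres.\<close>

lemma invol_nbhd: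
  assumes T: "openin (invol_topology P) T" and h: "h \<in> T"
  obtains n \<phi> where "n \<ge> 1" "epimorphism P (linear_graph n) \<phi>"
    "\<And>f. f \<in> invol_set P \<Longrightarrow>
      (\<And>y. y \<in> pts P \<Longrightarrow> \<exists>x\<in>pts P. \<phi> y = \<phi> x \<and> \<phi> (f y) = \<phi> (h x)) \<Longrightarrow> f \<in> T"
proof -
  have hI: "h \<in> invol_set P" using openin_subset[OF T] h topspace_invol_topology by blast
  then have cont: "continuous_map (top_of P) (top_of P) h"
    by (intro homeomorphic_imp_continuous_map aut_homeomorphic) (simp add: invol_set_def)
  have hin: "h x \<in> pts P" if "x \<in> pts P" for x
    using hI that aut_in by (auto simp: invol_set_def)
  obtain U where U: "openin (compact_open_topology (top_of P) (top_of P)) U"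
    and TU: "T = U \<inter> homeos (top_of P) \<inter> aut_set P \<inter> invol_set P"
    using T unfolding invol_topology_def aut_topology_def homeo_topology_def openin_subtopology
    by blast
  have "h \<in> U" using h TU by blast
  obtain \<W> where \<W>: "finite \<W>" "\<forall>W\<in>\<W>. openin (top_of P) W \<and> closedin (top_of P) W"
    and nb: "\<forall>f. f \<in> extensional (pts P) \<and> continuous_map (top_of P) (top_of P) f \<and>
      (\<forall>W\<in>\<W>. \<forall>x\<in>pts P. f x \<in> W \<longleftrightarrow> h x \<in> W) \<longrightarrow> f \<in> U"
    using compact_open_nbhd[OF limit_topological(3) U \<open>h \<in> U\<close>] .
  let ?pre = "\<lambda>W. {x \<in> pts P. h x \<in> W}"
  have fin: "finite (\<W> \<union> ?pre ` \<W>)" using \<W>(1) by simp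
  have clopen: "\<forall>W\<in>\<W> \<union> ?pre ` \<W>. openin (top_of P) W \<and> closedin (top_of P) W"
    using \<W>(2) openin_continuous_map_preimage[OF cont] closedin_continuous_map_preimage[OF cont]
    by auto
  obtain n \<phi> where n: "n \<ge> 1" and \<phi>: "epimorphism P (linear_graph n) \<phi>"
    and sat': "\<forall>W\<in>\<W> \<union> ?pre ` \<W>. \<forall>x\<in>pts P. \<forall>y\<in>pts P. \<phi> x = \<phi> y \<longrightarrow> (x \<in> W \<longleftrightarrow> y \<in> W)"
    using refine_clopens[OF fin clopen] .
  note sat = sat'[THEN bspec, THEN bspec, THEN bspec, THEN mp]
  show thesis
  proof (rule that[OF n \<phi>])
    fix f assume f: "f \<in> invol_set P"
      and pair: "\<And>y. y \<in> pts P \<Longrightarrow> \<exists>x\<in>pts P. \<phi> y = \<phi> x \<and> \<phi> (f y) = \<phi> (h x)"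
    have fa: "f \<in> aut_set P" using f by (simp add: invol_set_def)
    have "f \<in> U"
    proof (intro nb[rule_format] conjI ballI)
      show "f \<in> extensional (pts P)" using fa by (simp add: aut_set_def homeos_def)
      show "continuous_map (top_of P) (top_of P) f"
        using aut_homeomorphic[OF fa] by (rule homeomorphic_imp_continuous_map)
      fix W y assume W: "W \<in> \<W>" and y: "y \<in> pts P"
      obtain x where x: "x \<in> pts P" "\<phi> y = \<phi> x" "\<phi> (f y) = \<phi> (h x)" using pair[OF y] by blast
      \<comment> \<open>The first equivalence uses that \<open>W\<close> is saturated, with
        \<open>f y\<close> and \<open>h x\<close> in one fibre; the second uses that its preimage
        under \<open>h\<close> is saturated, with \<open>x\<close> and \<open>y\<close> in one
        fibre.\<close>
      have "f y \<in> W \<longleftrightarrow> h x \<in> W" using sat[of W "f y" "h x"] W x aut_in[OF fa y] hin by blast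
      also have "\<dots> \<longleftrightarrow> h y \<in> W" using sat[of "?pre W" y x] W x y by blast
      finally show "f y \<in> W \<longleftrightarrow> h y \<in> W" .
    qed
    then show "f \<in> T" using f fa by (simp add: TU aut_set_def)
  qed
qed

end

section \<open>Density of the orbit of the universal involution\<close>

theorem theorem2p2:
  fixes P :: "'a rstruct"
  assumes "projective_Fraisse_limit P"
  shows "\<exists>h\<in>invol_set P.
    (invol_topology P) closure_of (orbit (aut_group P) (conj_action P) h) = topspace (invol_topology P)"
proof -
  note P = assms
  obtain h where h: "h \<in> invol_set P"
    and univ: "\<And>q. q \<ge> 1 \<Longrightarrow>
      \<exists>\<theta>. epimorphism P (linear_graph q) \<theta> \<and> (\<forall>x\<in>pts P. \<theta> (h x) = flip q (\<theta> x))"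
    using universal_involution[OF P] by blast
  have ha: "h \<in> aut_set P" using h by (simp add: invol_set_def)
  have "orbit (aut_group P) (conj_action P) h \<inter> T \<noteq> {}"
    if T: "openin (invol_topology P) T" "T \<noteq> {}" for T
  proof -
    obtain h1 where h1: "h1 \<in> T" using T(2) by blast
    then have h1I: "h1 \<in> invol_set P" using openin_subset[OF T(1)] topspace_invol_topology by blast
    then have h1a: "h1 \<in> aut_set P" by (simp add: invol_set_def)
    obtain n \<phi> where n: "n \<ge> 1" and \<phi>: "epimorphism P (linear_graph n) \<phi>"
      and nb: "\<And>f. f \<in> invol_set P \<Longrightarrow>
        (\<And>y. y \<in> pts P \<Longrightarrow> \<exists>x\<in>pts P. \<phi> y = \<phi> x \<and> \<phi> (f y) = \<phi> (h1 x)) \<Longrightarrow> f \<in> T"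
      using invol_nbhd[OF P T(1) h1] by blast
    obtain m k where m: "m \<ge> 1" and k: "epimorphism (linear_graph m) (linear_graph n) k"
      and sym: "\<And>c. c \<in> {1..m} \<Longrightarrow> \<exists>x\<in>pts P. (k c, k (flip m c)) = (\<phi> x, (\<phi> \<circ> h1) x) \<or>
        (k c, k (flip m c)) = ((\<phi> \<circ> h1) x, \<phi> x)"
      using symmetric_chain[OF P n \<phi> epimorphism_compose[OF epimorphism_aut[OF h1a] \<phi>]] by blast
    obtain \<theta> where \<theta>: "epimorphism P (linear_graph m) \<theta>" "\<forall>x\<in>pts P. \<theta> (h x) = flip m (\<theta> x)"
      using univ[OF m] by blast
    \<comment> \<open>Homogeneity identifies \<open>k \<circ> \<theta>\<close> with
      \<open>\<phi> \<circ> g\<close>, so at \<open>g z\<close> the conjugate of \<open>h\<close>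
      realises the pair \<open>(k c, k (flip m c))\<close> with \<open>c = \<theta> z\<close>, which
      comes from \<open>h1\<close>.\<close>
    obtain g where g: "g \<in> aut_set P" "\<And>x. x \<in> pts P \<Longrightarrow> (k \<circ> \<theta>) x = \<phi> (g x)"
      using limit_homogeneous[OF P n \<phi> epimorphism_compose[OF \<theta>(1) k]] by blast
    let ?f = "conj_action P g h"
    have gc: "g \<in> carrier (aut_group P)" using g(1) by (simp add: carrier_aut_group)
    have f: "?f \<in> invol_set P"
      using group_action.element_image[OF group_action_conj_action gc h] by blast
    have "?f \<in> T"
    proof (rule nb[OF f])
      fix y assume "y \<in> pts P"
      then obtain z where z: "z \<in> pts P" "y = g z" using aut_onto[OF g(1)] by blast
      have c: "\<theta> z \<in> {1..m}" using epimorphism_image[OF \<theta>(1) z(1)] by simp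
      have "\<phi> y = k (\<theta> z)" using g(2)[OF z(1)] z(2) by simp
      moreover have "\<phi> (?f y) = k (flip m (\<theta> z))"
        using g(2)[OF aut_in[OF ha z(1)]] \<theta>(2) z conj_action_apply[OF g(1) h z(1)] by simp
      moreover obtain x where x: "x \<in> pts P"
        "(k (\<theta> z), k (flip m (\<theta> z))) = (\<phi> x, \<phi> (h1 x)) \<or> (k (\<theta> z), k (flip m (\<theta> z))) = (\<phi> (h1 x), \<phi> x)"
        using sym[OF c] by auto
      \<comment> \<open>A pair in exchanged order is the pair of \<open>h1\<close> at the point
        \<open>h1 x\<close>, since \<open>h1 (h1 x) = x\<close>.\<close>
      ultimately have "\<phi> y = \<phi> x \<and> \<phi> (?f y) = \<phi> (h1 x) \<or>
          \<phi> y = \<phi> (h1 x) \<and> \<phi> (?f y) = \<phi> (h1 (h1 x))"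
        using invol_apply[OF h1I x(1)] by auto
      then show "\<exists>x\<in>pts P. \<phi> y = \<phi> x \<and> \<phi> (?f y) = \<phi> (h1 x)"
        using x(1) aut_in[OF h1a x(1)] by blast
    qed
    moreover have "?f \<in> orbit (aut_group P) (conj_action P) h"
      using gc by (auto simp: orbit_def)
    ultimately show ?thesis by blast
  qed
  then have "(invol_topology P) closure_of (orbit (aut_group P) (conj_action P) h) =
      topspace (invol_topology P)"
    unfolding dense_intersects_open by blast
  with h show ?thesis by blast
qed

end
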